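(* Let $f=\prod_{i=1}^dL_i\in R_n=\mathbb C[x_1,\dots,x_n]$ be the defining polynomial of a hyperplane arrangement in $\mathbb C^n$, where the $L_i$ are (not necessarily homogeneous and not necessarily distinct) polynomials of degree one. Then the annihilator $\mathrm{ann}_{D_n}(1/f)=\{P\in D_n: P\bullet(1/f)=0\}$ is generated, as a left ideal of $D_n$, by differential operators of order one.
   Context: $D_n=R_n\langle\partial_1,\dots,\partial_n\rangle$ is the $n$-th Weyl algebra over $\mathbb C$, acting on the localization $R_n[1/f]$ in the usual way. The order of an operator is its degree in $\partial_1,\dots,\partial_n$. *)

theory Defs
  imports
    Complex_Main
    "HOL-Library.Poly_Mapping"
    "HOL-Computational_Algebra.Fraction_Field"
begin

hide_const (open) Rat.Fract

section \<open>Polynomials\<close>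

text \<open>
  The variables are indexed by a finite type \<open>'n\<close>, so \<open>n = CARD('n)\<close>. The linear order on \<open>'n\<close> is
  an enumeration of the variables; the library needs it to make the polynomial ring an integral
  domain, which is in turn needed for its fraction field.
\<close>

type_synonym 'n mindex = "'n \<Rightarrow>\<^sub>0 nat"
type_synonym 'n cpoly = "'n mindex \<Rightarrow>\<^sub>0 complex"

definition mdeg :: "'n::finite mindex \<Rightarrow> nat" where
  "mdeg \<alpha> = (\<Sum>i\<in>UNIV. Poly_Mapping.lookup \<alpha> i)"

text \<open>Largest \<open>|\<alpha>|\<close> in the support (\<open>0\<close> for the zero map): the total degree of a polynomial.\<close>

definition supp_deg :: "('n::finite mindex \<Rightarrow>\<^sub>0 'b::zero) \<Rightarrow> nat" where
  "supp_deg p = Max (insert 0 (mdeg ` Poly_Mapping.keys p))"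

abbreviation total_degree :: "'n::finite cpoly \<Rightarrow> nat" where
  "total_degree \<equiv> supp_deg"

definition pd :: "'n \<Rightarrow> 'n cpoly \<Rightarrow> 'n cpoly" where
  "pd i p = (\<Sum>\<alpha>\<in>Poly_Mapping.keys p.
     Poly_Mapping.single (\<alpha> - Poly_Mapping.single i 1)
       (of_nat (Poly_Mapping.lookup \<alpha> i) * Poly_Mapping.lookup p \<alpha>))"

lemma poly_mapping_sum_singles:
  "p = (\<Sum>\<alpha>\<in>Poly_Mapping.keys p. Poly_Mapping.single \<alpha> (Poly_Mapping.lookup p \<alpha>))"
  by (rule poly_mapping_eqI)
     (auto simp: lookup_sum lookup_single when_def in_keys_iff)

lemma poly_mapping_add_induct [case_names zero single add]:
  fixes p :: "'a \<Rightarrow>\<^sub>0 'b::comm_monoid_add"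
  assumes "P 0" "\<And>k c. P (Poly_Mapping.single k c)" "\<And>a b. P a \<Longrightarrow> P b \<Longrightarrow> P (a + b)"
  shows "P p"
proof -
  have "finite S \<Longrightarrow> P (\<Sum>\<alpha>\<in>S. Poly_Mapping.single \<alpha> (Poly_Mapping.lookup p \<alpha>))" for S
    by (induction S rule: finite_induct) (auto intro: assms)
  thus ?thesis
    by (subst poly_mapping_sum_singles) auto
qed

lemma pd_add: "pd i (p + q) = pd i p + pd i q"
  unfolding pd_def by (rule setsum_keys_plus_distrib) (auto simp: single_add algebra_simps)

lemma pd_zero [simp]: "pd i 0 = 0"
  by (simp add: pd_def)

lemma pd_single:
  "pd i (Poly_Mapping.single \<alpha> c) =
     Poly_Mapping.single (\<alpha> - Poly_Mapping.single i 1) (of_nat (Poly_Mapping.lookup \<alpha> i) * c)"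
  by (simp add: pd_def)

lemma pd_uminus: "pd i (- p) = - pd i p"
  using pd_add[of i p "- p"] by (simp add: eq_neg_iff_add_eq_0 add.commute)

lemma pd_diff: "pd i (p - q) = pd i p - pd i q"
  using pd_add[of i p "- q"] by (simp add: pd_uminus)

lemma pd_one [simp]: "pd i 1 = 0"
  using pd_single[of i 0 1] by simp

lemma pd_mult_single:
  fixes \<alpha> \<beta> :: "'n::{finite,linorder} mindex"
  shows "pd i (Poly_Mapping.single \<alpha> c * Poly_Mapping.single \<beta> d) =
    pd i (Poly_Mapping.single \<alpha> c) * Poly_Mapping.single \<beta> d
    + Poly_Mapping.single \<alpha> c * pd i (Poly_Mapping.single \<beta> d)"
proof -
  have shift: "Poly_Mapping.single (\<alpha> - Poly_Mapping.single i 1 + \<beta>)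
        (of_nat (Poly_Mapping.lookup \<alpha> i) * e) =
      Poly_Mapping.single (\<alpha> + \<beta> - Poly_Mapping.single i 1)
        (of_nat (Poly_Mapping.lookup \<alpha> i) * e)"
    for \<alpha> \<beta> :: "'n mindex" and e :: complex
  proof (cases "Poly_Mapping.lookup \<alpha> i = 0")
    case False
    hence "\<alpha> - Poly_Mapping.single i 1 + \<beta> = \<alpha> + \<beta> - Poly_Mapping.single i 1"
      by (intro poly_mapping_eqI) (auto simp: lookup_add lookup_minus lookup_single when_def)
    thus ?thesis by simp
  qed simp
  show ?thesis
    using shift[of \<alpha> \<beta> "c * d"] shift[of \<beta> \<alpha> "c * d"]
    by (simp add: mult_single pd_single lookup_add single_add algebra_simps)
qed

lemma pd_mult:
  fixes p q :: "'n::{finite,linorder} cpoly"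
  shows "pd i (p * q) = pd i p * q + p * pd i q"
proof (induction p rule: poly_mapping_add_induct)
  case (single \<alpha> c)
  show ?case
    by (induction q rule: poly_mapping_add_induct)
       (simp_all add: pd_mult_single pd_add algebra_simps)
qed (simp_all add: pd_add algebra_simps)

lemma pd_commute: "pd i (pd j p) = pd j (pd i p)"
proof (induction p rule: poly_mapping_add_induct)
  case (single \<alpha> c)
  have "\<alpha> - Poly_Mapping.single i 1 - Poly_Mapping.single j 1
      = \<alpha> - Poly_Mapping.single j 1 - Poly_Mapping.single i (1::nat)"
    by (intro poly_mapping_eqI) (simp add: lookup_minus)
  thus ?case
    by (cases "i = j") (simp_all add: pd_single lookup_minus lookup_single ac_simps)
qed (simp_all add: pd_add)


section \<open>Derivations on the field of rational functions\<close>

text \<open>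
  All localizations \<open>R\<^sub>n[1/f]\<close> with \<open>f \<noteq> 0\<close> are subrings of the fraction field of \<open>R\<^sub>n\<close>,
  with derivations given by the quotient rule.
\<close>

lemma quotient_rule_wd:
  fixes a b c d :: "'n::{finite,linorder} cpoly"
  assumes "a * d = c * b"
  shows "(pd i a * b - a * pd i b) * (d * d) = (pd i c * d - c * pd i d) * (b * b)"
proof -
  have "pd i a * d + a * pd i d = pd i c * b + c * pd i b"
    using arg_cong[OF assms, of "pd i"] by (simp add: pd_mult)
  hence e: "pd i a * d = pd i c * b + c * pd i b - a * pd i d"
    by (simp add: algebra_simps)
  have "(pd i a * b - a * pd i b) * (d * d) = b * d * (pd i a * d) - (a * d) * (pd i b * d)"
    by (simp add: algebra_simps)
  also have "\<dots> = b * d * (pd i c * b + c * pd i b) - (a * d) * b * pd i d - (a * d) * (pd i b * d)"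
    unfolding e by (simp add: algebra_simps)
  also have "\<dots> = (pd i c * d - c * pd i d) * (b * b)"
    unfolding assms by (simp add: algebra_simps)
  finally show ?thesis .
qed

lift_definition fpd :: "'n::{finite,linorder} \<Rightarrow> 'n cpoly fract \<Rightarrow> 'n cpoly fract"
  is "\<lambda>i r. (pd i (fst r) * snd r - fst r * pd i (snd r), snd r * snd r)"
  unfolding fractrel_iff fst_conv snd_conv
  by (elim conjE, intro conjI no_zero_divisors quotient_rule_wd)

lemma fpd_Fract:
  "b \<noteq> 0 \<Longrightarrow> fpd i (Fract a b) = Fract (pd i a * b - a * pd i b) (b * b)"
  by (simp add: Fract.abs_eq fpd.abs_eq)

lemma fpd_add: "fpd i (r + s) = fpd i r + fpd i s"
  by (cases r; cases s) (simp add: fpd_Fract eq_fract pd_mult pd_add algebra_simps)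

lemma fpd_mult: "fpd i (r * s) = fpd i r * s + r * fpd i s"
  by (cases r; cases s) (simp add: fpd_Fract eq_fract pd_mult algebra_simps)

lemma fpd_poly: "fpd i (Fract a 1) = Fract (pd i a) 1"
  by (simp add: fpd_Fract)

lemma fpd_commute: "fpd i (fpd j r) = fpd j (fpd i r)"
  by (cases r) (simp add: fpd_Fract eq_fract pd_mult pd_diff pd_commute[of i j] algebra_simps)


section \<open>Evaluating differential operators in normal form\<close>

text \<open>
  A finitely supported family \<open>P\<close> of polynomials stands for the operator
  \<open>\<Sum>\<alpha>. P\<^sub>\<alpha> \<partial>\<^sup>\<alpha>\<close>. It can be evaluated as soon as polynomials act by some \<open>s\<close> and the
  \<open>\<partial>\<^sub>i\<close> by commuting maps \<open>D i\<close>.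
\<close>

type_synonym 'n normal_form = "'n mindex \<Rightarrow>\<^sub>0 'n cpoly"

definition mpow :: "('n::{finite,linorder} \<Rightarrow> 'b \<Rightarrow> 'b) \<Rightarrow> 'n mindex \<Rightarrow> 'b \<Rightarrow> 'b" where
  "mpow D \<alpha> = foldr (\<lambda>i h. (D i ^^ Poly_Mapping.lookup \<alpha> i) \<circ> h) (sorted_list_of_set UNIV) id"

definition eval_nf ::
  "('n::{finite,linorder} cpoly \<Rightarrow> 'b \<Rightarrow> 'b) \<Rightarrow> ('n \<Rightarrow> 'b \<Rightarrow> 'b) \<Rightarrow> 'n normal_form \<Rightarrow> 'b \<Rightarrow> 'b::comm_monoid_add"
  where
  "eval_nf s D P x =
     (\<Sum>\<alpha>\<in>Poly_Mapping.keys P. s (Poly_Mapping.lookup P \<alpha>) (mpow D \<alpha> x))"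

text \<open>
  Left multiplication of normal forms by a polynomial and by \<open>\<partial>\<^sub>i\<close>; the latter is
  \<open>\<partial>\<^sub>i (\<Sum>\<alpha>. a\<^sub>\<alpha> \<partial>\<^sup>\<alpha>) = \<Sum>\<alpha>. (\<partial>a\<^sub>\<alpha>/\<partial>x\<^sub>i) \<partial>\<^sup>\<alpha> + a\<^sub>\<alpha> \<partial>\<^sup>\<alpha> \<partial>\<^sub>i\<close>, as dictated by the relation
  \<open>\<partial>\<^sub>i a = a \<partial>\<^sub>i + \<partial>a/\<partial>x\<^sub>i\<close>. (The \<open>*\<close> below is the commutative product, used as an index shift.)
\<close>

definition nf_scale :: "'n cpoly \<Rightarrow> 'n normal_form \<Rightarrow> 'n normal_form" where
  "nf_scale a P = Poly_Mapping.map ((*) a) P"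

definition nf_pd :: "'n \<Rightarrow> 'n normal_form \<Rightarrow> 'n normal_form" where
  "nf_pd i P = Poly_Mapping.map (pd i) P + Poly_Mapping.single (Poly_Mapping.single i 1) 1 * P"

lemma lookup_nf_scale [simp]:
  "Poly_Mapping.lookup (nf_scale a P) \<alpha> = a * Poly_Mapping.lookup P \<alpha>"
  by (simp add: nf_scale_def map.rep_eq when_def)

lemma lookup_map_pd [simp]:
  "Poly_Mapping.lookup (Poly_Mapping.map (pd i) P) \<alpha> = pd i (Poly_Mapping.lookup P \<alpha>)"
  by (simp add: map.rep_eq when_def)

lemma map_pd_add:
  "Poly_Mapping.map (pd i) (P + Q) = Poly_Mapping.map (pd i) P + Poly_Mapping.map (pd i) Q"
  by (intro poly_mapping_eqI) (simp add: lookup_add pd_add)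

lemma nf_pd_add: "nf_pd i (P + Q) = nf_pd i P + nf_pd i Q"
  by (simp add: nf_pd_def map_pd_add algebra_simps)

lemma nf_scale_add: "nf_scale a (P + Q) = nf_scale a P + nf_scale a Q"
  by (intro poly_mapping_eqI) (simp add: lookup_add algebra_simps)

lemma nf_scale_add_left: "nf_scale (a + b) P = nf_scale a P + nf_scale b P"
  by (intro poly_mapping_eqI) (simp add: lookup_add algebra_simps)

lemma nf_scale_mult: "nf_scale (a * b) P = nf_scale a (nf_scale b P)"
  by (intro poly_mapping_eqI) (simp add: algebra_simps)

lemma nf_scale_one [simp]: "nf_scale 1 P = P"
  by (intro poly_mapping_eqI) simp

lemma nf_scale_single [simp]:
  "nf_scale a (Poly_Mapping.single \<alpha> b) = Poly_Mapping.single \<alpha> (a * b)"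
  by (simp add: nf_scale_def)

lemma nf_pd_single:
  "nf_pd i (Poly_Mapping.single \<alpha> a) =
     Poly_Mapping.single \<alpha> (pd i a) + Poly_Mapping.single (\<alpha> + Poly_Mapping.single i 1) a"
  by (simp add: nf_pd_def mult_single add.commute)

lemma nf_pd_commute: "nf_pd i (nf_pd j P) = nf_pd j (nf_pd i P)"
proof (induction P rule: poly_mapping_add_induct)
  case zero
  have "nf_pd k 0 = 0" for k :: 'a
    using nf_pd_add[of k 0 0] by simp
  thus ?case by simp
next
  case (single \<alpha> a)
  show ?case by (simp add: nf_pd_single nf_pd_add pd_commute[of i j] ac_simps)
qed (simp add: nf_pd_add)

lemma nf_pd_scale:
  fixes P :: "'n::{finite,linorder} normal_form"
  shows "nf_pd i (nf_scale a P) = nf_scale a (nf_pd i P) + nf_scale (pd i a) P"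
proof (induction P rule: poly_mapping_add_induct)
  case zero
  have "nf_pd i 0 = 0" "\<And>a::'n cpoly. nf_scale a 0 = 0"
    using nf_pd_add[of i 0 0] nf_scale_add[of _ 0 0] by simp_all
  thus ?case by simp
next
  case (single \<alpha> b)
  show ?case by (simp add: nf_pd_single nf_scale_add pd_mult single_add ac_simps)
qed (simp add: nf_pd_add nf_scale_add ac_simps)

locale weyl_rep =
  fixes s :: "'n::{finite,linorder} cpoly \<Rightarrow> 'b \<Rightarrow> 'b::ab_group_add"
    and D :: "'n \<Rightarrow> 'b \<Rightarrow> 'b"
  assumes s_add_left: "s (a + b) x = s a x + s b x"
    and s_add: "s a (x + y) = s a x + s a y"
    and s_mult: "s (a * b) x = s a (s b x)"
    and s_one: "s 1 x = x"
    and D_add: "D i (x + y) = D i x + D i y"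
    and D_commute: "D i (D j x) = D j (D i x)"
    and D_s: "D i (s a x) = s a (D i x) + s (pd i a) x"
begin

lemma s_zero_left [simp]: "s 0 x = 0"
  using s_add_left[of 0 0 x] by simp

lemma s_zero [simp]: "s a 0 = 0"
  using s_add[of a 0 0] by simp

lemma D_zero [simp]: "D i 0 = 0"
  using D_add[of i 0 0] by simp

lemma D_pow_add: "(D i ^^ k) (x + y) = (D i ^^ k) x + (D i ^^ k) y"
  by (induction k) (simp_all add: D_add)

lemma D_D_pow: "D i ((D j ^^ k) x) = (D j ^^ k) (D i x)"
  by (induction k) (simp_all add: D_commute[of i j])

lemma mpow_zero [simp]: "mpow D 0 x = x"
proof -
  have "foldr (\<lambda>i h. (D i ^^ Poly_Mapping.lookup 0 i) \<circ> h) xs id = id" for xs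
    by (induction xs) simp_all
  thus ?thesis by (simp add: mpow_def)
qed

lemma mpow_add: "mpow D \<alpha> (x + y) = mpow D \<alpha> x + mpow D \<alpha> y"
proof -
  have "foldr (\<lambda>i h. (D i ^^ Poly_Mapping.lookup \<alpha> i) \<circ> h) xs id (x + y) =
      foldr (\<lambda>i h. (D i ^^ Poly_Mapping.lookup \<alpha> i) \<circ> h) xs id x +
      foldr (\<lambda>i h. (D i ^^ Poly_Mapping.lookup \<alpha> i) \<circ> h) xs id y" for xs
    by (induction xs) (simp_all add: D_pow_add)
  thus ?thesis by (simp add: mpow_def)
qed

lemma mpow_step: "mpow D (\<alpha> + Poly_Mapping.single i 1) x = D i (mpow D \<alpha> x)"
proof -
  let ?\<beta> = "\<alpha> + Poly_Mapping.single i (1::nat)"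
  let ?F = "\<lambda>\<alpha> xs. foldr (\<lambda>i h. (D i ^^ Poly_Mapping.lookup \<alpha> i) \<circ> h) xs id"
  have notin: "i \<notin> set xs \<Longrightarrow> ?F ?\<beta> xs = ?F \<alpha> xs" for xs
    by (induction xs) (auto simp: lookup_add lookup_single when_def)
  have "distinct xs \<Longrightarrow> i \<in> set xs \<Longrightarrow> ?F ?\<beta> xs x = D i (?F \<alpha> xs x)" for xs
  proof (induction xs)
    case (Cons j xs)
    show ?case
    proof (cases "i = j")
      case True
      hence "i \<notin> set xs" using Cons.prems by simp
      note F = notin[OF this, unfolded True]
      have step: "?F \<gamma> (j # xs) x = (D j ^^ Poly_Mapping.lookup \<gamma> j) (?F \<gamma> xs x)" for \<gamma>
        by simp
      have "Poly_Mapping.lookup (\<alpha> + Poly_Mapping.single j 1) j = Suc (Poly_Mapping.lookup \<alpha> j)"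
        by (simp add: lookup_add)
      thus ?thesis
        unfolding step True F by simp
    next
      case False
      thus ?thesis using Cons by (simp add: lookup_add lookup_single D_D_pow)
    qed
  qed simp
  thus ?thesis by (simp add: mpow_def)
qed

abbreviation ev where "ev \<equiv> eval_nf s D"

lemma ev_add_left: "ev (P + Q) x = ev P x + ev Q x"
  unfolding eval_nf_def by (rule setsum_keys_plus_distrib) (simp_all add: s_add_left)

lemma ev_zero_left [simp]: "ev 0 x = 0"
  by (simp add: eval_nf_def)

lemma ev_add: "ev P (x + y) = ev P x + ev P y"
  by (simp add: eval_nf_def mpow_add s_add sum.distrib)

lemma ev_zero [simp]: "ev P 0 = 0"
  using ev_add[of P 0 0] by simp

lemma ev_single: "ev (Poly_Mapping.single \<alpha> a) x = s a (mpow D \<alpha> x)"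
  by (simp add: eval_nf_def)

lemma ev_scale: "ev (nf_scale a P) x = s a (ev P x)"
proof (induction P rule: poly_mapping_add_induct)
  case zero
  have "nf_scale a 0 = 0" using nf_scale_add[of a 0 0] by simp
  thus ?case by simp
qed (simp_all add: nf_scale_add ev_add_left ev_single s_mult s_add)

lemma ev_pd: "ev (nf_pd i P) x = D i (ev P x)"
proof (induction P rule: poly_mapping_add_induct)
  case zero
  have "nf_pd i 0 = 0" using nf_pd_add[of i 0 0] by simp
  thus ?case by simp
qed (simp_all add: nf_pd_add nf_pd_single ev_add_left ev_single mpow_step D_s D_add add.commute del: One_nat_def)

lemma ev_mpow: "ev (mpow nf_pd \<alpha> P) x = mpow D \<alpha> (ev P x)"
proof -
  have pow: "ev ((nf_pd i ^^ k) P) x = (D i ^^ k) (ev P x)" for i k P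
    by (induction k) (simp_all add: ev_pd)
  have "ev (foldr (\<lambda>i h. (nf_pd i ^^ Poly_Mapping.lookup \<alpha> i) \<circ> h) xs id P) x =
      foldr (\<lambda>i h. (D i ^^ Poly_Mapping.lookup \<alpha> i) \<circ> h) xs id (ev P x)" for xs
    by (induction xs) (simp_all add: pow)
  thus ?thesis by (simp add: mpow_def)
qed

lemma ev_mult: "ev (eval_nf nf_scale nf_pd P Q) x = ev P (ev Q x)"
proof -
  have "ev (\<Sum>\<alpha>\<in>A. f \<alpha>) x = (\<Sum>\<alpha>\<in>A. ev (f \<alpha>) x)" for A and f :: "'n mindex \<Rightarrow> 'n normal_form"
    by (induction A rule: infinite_finite_induct) (simp_all add: ev_add_left)
  thus ?thesis
    by (simp add: eval_nf_def[of nf_scale] ev_scale ev_mpow) (simp add: eval_nf_def[of s D P])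
qed

end

interpretation nf: weyl_rep nf_scale nf_pd
  by unfold_locales
     (simp_all add: nf_scale_add_left nf_scale_add nf_scale_mult nf_pd_add nf_pd_scale nf_pd_commute)

interpretation fr: weyl_rep "\<lambda>a r. Fract a 1 * r" fpd
proof
  fix a b :: "'n::{finite,linorder} cpoly" and x y :: "'n cpoly fract" and i j :: "'n::{finite,linorder}"
  have "Fract (a + b) 1 = Fract a 1 + Fract b 1" by simp
  thus "Fract (a + b) 1 * x = Fract a 1 * x + Fract b 1 * x"
    by (simp only: distrib_right)
  have "Fract (a * b) 1 = Fract a 1 * Fract b 1" by simp
  thus "Fract (a * b) 1 * x = Fract a 1 * (Fract b 1 * x)"
    by (simp only: mult.assoc)
  show "fpd i (Fract a 1 * x) = Fract a 1 * fpd i x + Fract (pd i a) 1 * x"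
    by (simp only: fpd_mult fpd_poly add.commute)
qed (simp_all add: distrib_left fpd_add fpd_commute flip: One_fract_def)


section \<open>The Weyl algebra\<close>

text \<open>
  \<open>D\<^sub>n = R\<^sub>n\<langle>\<partial>\<^sub>1,\<dots>,\<partial>\<^sub>n\<rangle>\<close> as the free left \<open>R\<^sub>n\<close>-module on the monomials \<open>\<partial>\<^sup>\<alpha>\<close>, with the
  multiplication determined by the defining relations, which are proved below. A separate type is
  needed since the library's product on normal forms is the commutative one.
\<close>

typedef 'n weyl = "UNIV :: 'n normal_form set"
  morphisms weyl_coeffs Weyl ..

setup_lifting type_definition_weyl

lemma nf_mult_one: "eval_nf nf_scale nf_pd P 1 = P"
proof (induction P rule: poly_mapping_add_induct)
  case (single \<alpha> a)
  have pow: "(nf_pd i ^^ k) (Poly_Mapping.single \<beta> 1) =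
      Poly_Mapping.single (\<beta> + Poly_Mapping.single i k) 1" for i k and \<beta> :: "'a mindex"
    by (induction k) (simp_all add: nf_pd_single single_add ac_simps flip: single_add)
  have "distinct xs \<Longrightarrow>
      foldr (\<lambda>i h. (nf_pd i ^^ Poly_Mapping.lookup \<alpha> i) \<circ> h) xs id 1 =
      Poly_Mapping.single (\<Sum>i\<in>set xs. Poly_Mapping.single i (Poly_Mapping.lookup \<alpha> i)) 1" for xs
    by (induction xs) (simp_all add: pow ac_simps)
  from this[of "sorted_list_of_set UNIV"]
  have "mpow nf_pd \<alpha> 1 =
      Poly_Mapping.single (\<Sum>i\<in>UNIV. Poly_Mapping.single i (Poly_Mapping.lookup \<alpha> i)) 1"
    by (simp add: mpow_def)
  also have "(\<Sum>i\<in>UNIV. Poly_Mapping.single i (Poly_Mapping.lookup \<alpha> i)) = \<alpha>"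
    by (rule poly_mapping_eqI) (simp add: lookup_sum lookup_single when_def)
  finally show ?case
    by (simp add: nf.ev_single)
qed (simp_all add: nf.ev_add_left)

instantiation weyl :: ("{finite,linorder}") ring_1
begin

lift_definition zero_weyl :: "'a weyl" is 0 .
lift_definition one_weyl :: "'a weyl" is 1 .
lift_definition plus_weyl :: "'a weyl \<Rightarrow> 'a weyl \<Rightarrow> 'a weyl" is "(+)" .
lift_definition minus_weyl :: "'a weyl \<Rightarrow> 'a weyl \<Rightarrow> 'a weyl" is "(-)" .
lift_definition uminus_weyl :: "'a weyl \<Rightarrow> 'a weyl" is uminus .
lift_definition times_weyl :: "'a weyl \<Rightarrow> 'a weyl \<Rightarrow> 'a weyl" is "eval_nf nf_scale nf_pd" .

instance
proof
  fix P Q R :: "'a weyl"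
  show "P * Q * R = P * (Q * R)" by transfer (rule nf.ev_mult)
  show "1 * P = P" by transfer (use nf.ev_single[of 0 1] in simp)
  show "P * 1 = P" by transfer (rule nf_mult_one)
  show "(P + Q) * R = P * R + Q * R" by transfer (rule nf.ev_add_left)
  show "P * (Q + R) = P * Q + P * R" by transfer (rule nf.ev_add)
  show "(0 :: 'a weyl) \<noteq> 1" by transfer simp
qed (transfer; simp add: algebra_simps)+

end

definition wpoly :: "'n cpoly \<Rightarrow> 'n weyl" where
  "wpoly a = Weyl (Poly_Mapping.single 0 a)"

definition wd :: "'n \<Rightarrow> 'n weyl" where
  "wd i = Weyl (Poly_Mapping.single (Poly_Mapping.single i 1) 1)"

text \<open>The order of \<open>\<Sum>\<alpha>. a\<^sub>\<alpha> \<partial>\<^sup>\<alpha>\<close> is its degree in the \<open>\<partial>\<^sub>i\<close>.\<close>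

definition weyl_order :: "'n::finite weyl \<Rightarrow> nat" where
  "weyl_order P = supp_deg (weyl_coeffs P)"

definition act :: "'n::{finite,linorder} weyl \<Rightarrow> 'n cpoly fract \<Rightarrow> 'n cpoly fract" where
  "act P r = eval_nf (\<lambda>a r. Fract a 1 * r) fpd (weyl_coeffs P) r"

definition ann :: "'n::{finite,linorder} cpoly fract \<Rightarrow> 'n weyl set" where
  "ann r = {P. act P r = 0}"

definition left_ideal :: "'a::ring_1 set \<Rightarrow> bool" where
  "left_ideal I \<longleftrightarrow> 0 \<in> I \<and> (\<forall>x\<in>I. \<forall>y\<in>I. x + y \<in> I) \<and> (\<forall>x\<in>I. \<forall>r. r * x \<in> I)"


subsection \<open>The defining relations and the module structure\<close>

lemma weyl_coeffs_wpoly [simp]: "weyl_coeffs (wpoly a) = Poly_Mapping.single 0 a"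
  by (simp add: wpoly_def Weyl_inverse)

lemma weyl_coeffs_wd: "weyl_coeffs (wd i) = Poly_Mapping.single (Poly_Mapping.single i 1) 1"
  by (simp add: wd_def Weyl_inverse)

lemma weyl_eqI: "weyl_coeffs P = weyl_coeffs Q \<Longrightarrow> P = Q"
  by (simp add: weyl_coeffs_inject)

lemma wpoly_mult: "wpoly (a * b) = wpoly a * wpoly (b :: 'n::{finite,linorder} cpoly)"
  by (rule weyl_eqI) (simp add: times_weyl.rep_eq nf.ev_single)

lemma wpoly_add: "wpoly (a + b) = wpoly a + wpoly (b :: 'n::{finite,linorder} cpoly)"
  by (rule weyl_eqI) (simp add: plus_weyl.rep_eq single_add)

lemma wpoly_one: "wpoly 1 = (1 :: 'n::{finite,linorder} weyl)"
  by (rule weyl_eqI) (simp add: one_weyl.rep_eq)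

lemma nf_mult_d:
  "eval_nf nf_scale nf_pd (Poly_Mapping.single (Poly_Mapping.single i 1) 1) P = nf_pd i P"
  using nf.mpow_step[of 0 i P] by (simp add: nf.ev_single)

lemma wd_commute: "wd i * wd j = wd j * wd (i :: 'n::{finite,linorder})"
  by (rule weyl_eqI)
     (simp only: times_weyl.rep_eq weyl_coeffs_wd nf_mult_d nf_pd_single, simp add: add.commute)

lemma wd_wpoly: "wd i * wpoly a = wpoly a * wd i + wpoly (pd i a)"
  by (rule weyl_eqI)
     (simp only: times_weyl.rep_eq plus_weyl.rep_eq weyl_coeffs_wd weyl_coeffs_wpoly nf_mult_d nf_pd_single,
      simp add: nf.ev_single add.commute)

text \<open>Every element is \<open>\<Sum>\<alpha>. a\<^sub>\<alpha> \<partial>\<^sup>\<alpha>\<close>.\<close>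

lemma weyl_normal_form:
  "P = (\<Sum>\<alpha>\<in>Poly_Mapping.keys (weyl_coeffs P).
          wpoly (Poly_Mapping.lookup (weyl_coeffs P) \<alpha>) * mpow (\<lambda>i. (*) (wd i)) \<alpha> 1)"
proof -
  have pow: "weyl_coeffs (((*) (wd i) ^^ k) Q) = (nf_pd i ^^ k) (weyl_coeffs Q)" for i :: 'a and k Q
    by (induction k) (simp_all add: times_weyl.rep_eq weyl_coeffs_wd nf_mult_d del: One_nat_def)
  have "weyl_coeffs (foldr (\<lambda>i h. ((*) (wd i) ^^ Poly_Mapping.lookup \<alpha> i) \<circ> h) xs id 1) =
      foldr (\<lambda>i h. (nf_pd i ^^ Poly_Mapping.lookup \<alpha> i) \<circ> h) xs id 1" for xs and \<alpha> :: "'a mindex"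
    by (induction xs) (simp_all add: pow one_weyl.rep_eq)
  hence m: "weyl_coeffs (mpow (\<lambda>i. (*) (wd i)) \<alpha> 1) = mpow nf_pd \<alpha> 1" for \<alpha> :: "'a mindex"
    by (simp add: mpow_def)
  have sum: "weyl_coeffs (\<Sum>\<alpha>\<in>A. f \<alpha>) = (\<Sum>\<alpha>\<in>A. weyl_coeffs (f \<alpha>))" for A and f :: "'a mindex \<Rightarrow> 'a weyl"
    by (induction A rule: infinite_finite_induct) (simp_all add: zero_weyl.rep_eq plus_weyl.rep_eq)
  show ?thesis
    unfolding weyl_coeffs_inject[symmetric] sum
    by (subst nf_mult_one[symmetric])
       (simp add: times_weyl.rep_eq m nf.ev_single, simp add: eval_nf_def)
qed

lemma act_mult: "act (P * Q) r = act P (act Q r)"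
  by (simp add: act_def times_weyl.rep_eq fr.ev_mult)

lemma act_one: "act 1 r = r"
  using fr.ev_single[of 0 1 r] by (simp add: act_def one_weyl.rep_eq flip: One_fract_def)

lemma act_add_left: "act (P + Q) r = act P r + act Q r"
  by (simp add: act_def plus_weyl.rep_eq fr.ev_add_left)

lemma act_add: "act P (r + t) = act P r + act P t"
  by (simp add: act_def fr.ev_add)

lemma act_wpoly: "act (wpoly a) r = Fract a 1 * r"
  by (simp add: act_def fr.ev_single)

lemma act_wd: "act (wd i) r = fpd i r"
  using fr.mpow_step[of 0 i r] by (simp add: act_def weyl_coeffs_wd fr.ev_single flip: One_fract_def)

text \<open>The action restricts to the localization \<open>R\<^sub>n[1/f]\<close>.\<close>

definition localization :: "'a::idom \<Rightarrow> 'a fract set" where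
  "localization f = {Fract a (f ^ k) | a k. True}"

lemma act_localization:
  assumes "f \<noteq> 0" "r \<in> localization f"
  shows "act P r \<in> localization f"
proof -
  have add: "x + y \<in> localization f" if xy: "x \<in> localization f" "y \<in> localization f" for x y
  proof -
    from xy obtain a k b l where "x = Fract a (f ^ k)" "y = Fract b (f ^ l)"
      by (auto simp: localization_def)
    hence "x + y = Fract (a * f ^ l + b * f ^ k) (f ^ (k + l))"
      using assms(1) by (simp add: power_add)
    thus ?thesis unfolding localization_def by blast
  qed
  have d: "fpd i x \<in> localization f" if x: "x \<in> localization f" for i x
  proof -
    from x obtain a k where "x = Fract a (f ^ k)"
      by (auto simp: localization_def)
    hence "fpd i x = Fract (pd i a * f ^ k - a * pd i (f ^ k)) (f ^ (k + k))"
      using assms(1) by (simp add: fpd_Fract power_add)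
    thus ?thesis unfolding localization_def by blast
  qed
  have s: "Fract a 1 * x \<in> localization f" if "x \<in> localization f" for a x
    using that by (force simp: localization_def)
  have dk: "(fpd i ^^ k) x \<in> localization f" if "x \<in> localization f" for i k x
    using that by (induction k) (auto intro: d)
  have "foldr (\<lambda>i h. (fpd i ^^ Poly_Mapping.lookup \<alpha> i) \<circ> h) xs id r \<in> localization f" for \<alpha> xs
    by (induction xs) (auto intro: dk assms)
  hence m: "mpow fpd \<alpha> r \<in> localization f" for \<alpha>
    by (simp add: mpow_def)
  have "Fract 0 (f ^ 0) \<in> localization f"
    unfolding localization_def by blast
  hence "0 \<in> localization f"
    by (simp add: Zero_fract_def)
  hence "(\<Sum>\<alpha>\<in>A. Fract (c \<alpha>) 1 * mpow fpd \<alpha> r) \<in> localization f" for A c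
    by (induction A rule: infinite_finite_induct) (auto intro: add s m)
  thus ?thesis
    by (simp add: act_def eval_nf_def)
qed

end

theory Submission
  imports Defs
begin

text \<open>
  For a finite family \<open>A\<close> of nonzero affine forms write \<open>f\<^sub>A\<close> for its product and \<open>I\<^sub>A\<close> for the left
  ideal generated by the operators of order one that annihilate \<open>1/f\<^sub>A\<close>. The inclusion
  \<open>I\<^sub>A \<subseteq> ann(1/f\<^sub>A)\<close> is clear. For the converse the statement is strengthened so that forms can be
  removed one at a time. Let \<open>K \<subseteq> A\<close> consist of forms with linearly independent linear parts and put
  \<open>N(K,A) = \<Sum>\<^sub>k\<^sub>\<in>\<^sub>K R[1/f\<^sub>A\<^sub>-\<^sub>k]\<close> and \<open>J(K,A) = I\<^sub>A + \<Sum>\<^sub>k\<^sub>\<in>\<^sub>K D L\<^sub>k\<close>.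

  The claim is: \<^emph>\<open>if \<open>P \<bullet> (1/f\<^sub>A)\<close> lies in \<open>N(K,A)\<close>, then \<open>P\<close> lies in \<open>J(K,A)\<close>\<close>
  (lemma \<open>mem_rel_ideal_if_act_less_polar\<close>). For \<open>K = {}\<close> it says \<open>ann(1/f\<^sub>A) \<subseteq> I\<^sub>A\<close>.

  The proof is by induction on the number of forms in \<open>A - K\<close>, for all \<open>K\<close> at once. Choose vectors
  \<open>v\<^sub>k\<close> dual to the linear parts of the \<open>L\<^sub>k\<close>, \<open>k \<in> K\<close>.

  \<^item> Suppose some \<open>L\<^sub>s\<close> with \<open>s \<in> A - K\<close> does not vanish identically on \<open>V(K)\<close>, the common zero set of
    the \<open>L\<^sub>k\<close>. Then \<open>P \<in> J(K,A) + D L\<^sub>s\<close>: either \<open>K \<union> {s}\<close> is again independent and the induction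
    hypothesis applies to it, or \<open>L\<^sub>s\<close> is a nonzero constant modulo the \<open>L\<^sub>k\<close> and this is trivial.
    So \<open>P \<equiv> B L\<^sub>s\<close>, and \<open>B \<bullet> (1/f\<^sub>A\<^sub>-\<^sub>s)\<close> lies in \<open>N(K,A) \<inter> R[1/f\<^sub>A\<^sub>-\<^sub>s]\<close>. This intersection is
    \<open>N(K,A-s)\<close>, because \<open>L\<^sub>s\<close> is a nonzerodivisor modulo powers of the \<open>L\<^sub>k\<close> (lemmas
    \<open>nonzerodivisor_pow_ideal\<close> and \<open>less_polar_remove\<close>). By induction \<open>B \<in> J(K,A-s)\<close>, and
    \<open>I\<^sub>A\<^sub>-\<^sub>s L\<^sub>s \<subseteq> I\<^sub>A\<close> gives \<open>B L\<^sub>s \<in> J(K,A)\<close>.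
  \<^item> Suppose \<open>A - K\<close> is nonempty and all its members vanish on \<open>V(K)\<close>. Then the Euler field
    \<open>E = \<Sum>\<^sub>k L\<^sub>k \<partial>\<^sub>v\<^sub>k\<close> maps every form of \<open>A\<close> to itself, so that \<open>E + |A|\<close> kills \<open>1/f\<^sub>A\<close>; but
    \<open>E = \<Sum>\<^sub>k \<partial>\<^sub>v\<^sub>k L\<^sub>k - |K|\<close>. Hence the nonzero constant \<open>|A| - |K|\<close> lies in \<open>J(K,A)\<close>, which is
    therefore all of \<open>D\<close> (lemma \<open>mem_rel_ideal_dependent\<close>).
  \<^item> Suppose \<open>A = K\<close>. Here one inducts on the order of \<open>P\<close>, comparing \<open>P\<close> with its commutators
    \<open>[P, L\<^sub>k]\<close>, which have smaller order and satisfy the same hypothesis (lemma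
    \<open>mem_rel_ideal_independent\<close>).
\<close>

section \<open>Polynomials\<close>

abbreviation cst :: "complex \<Rightarrow> 'n cpoly" where "cst c \<equiv> Poly_Mapping.single 0 c"

definition var :: "'n \<Rightarrow> 'n cpoly" where
  "var i = Poly_Mapping.single (Poly_Mapping.single i 1) 1"

lemma cst_add: "cst (a + b) = cst a + cst b" by (rule single_add)

lemma cst_mult: "cst (a * b) = cst a * cst b" by (simp add: mult_single)

lemma pd_cst [simp]: "pd i (cst c) = 0" by (simp add: pd_single)

lemma pd_var: "pd i (var j) = (if i = j then 1 else 0)"
  by (auto simp: var_def pd_single lookup_single when_def)

lemma pd_cst_mult: "pd i (cst c * p) = cst c * pd i (p :: 'n::{finite,linorder} cpoly)"
  by (simp add: pd_mult)

lemma pd_sum: "pd i (sum g A) = (\<Sum>a\<in>A. pd i (g a))"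
  by (induction A rule: infinite_finite_induct) (simp_all add: pd_add)

lemma cpoly_induct [case_names cst var add mult]:
  fixes p :: "'n::{finite,linorder} cpoly"
  assumes c: "\<And>c. Q (cst c)" and v: "\<And>i. Q (var i)"
    and a: "\<And>p q. Q p \<Longrightarrow> Q q \<Longrightarrow> Q (p + q)" and m: "\<And>p q. Q p \<Longrightarrow> Q q \<Longrightarrow> Q (p * q)"
  shows "Q p"
proof (induction p rule: poly_mapping_add_induct)
  case zero
  show ?case using c[of 0] by simp
next
  case (single \<alpha> c0)
  have "Q (Poly_Mapping.single \<alpha> 1)"
  proof (induction \<alpha> rule: poly_mapping_add_induct)
    case zero show ?case using c[of 1] by simp
  next
    case (single i k)
    have "Q (Poly_Mapping.single (Poly_Mapping.single i k) 1)"
    proof (induction k)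
      case 0 show ?case using c[of 1] by simp
    next
      case (Suc k)
      have "Poly_Mapping.single (Poly_Mapping.single i (Suc k)) 1 = Poly_Mapping.single (Poly_Mapping.single i k) 1 * var i"
        by (simp add: var_def mult_single flip: single_add)
      thus ?case using m[OF Suc v[of i]] by simp
    qed
    thus ?case .
  next
    case (add \<alpha> \<beta>)
    thus ?case using m[OF add] by (simp add: mult_single)
  qed
  from m[OF c[of c0] this] show ?case by (simp add: mult_single)
qed (rule a)

definition poly_subst :: "('n::{finite,linorder} \<Rightarrow> 'n cpoly) \<Rightarrow> 'n cpoly \<Rightarrow> 'n cpoly" where
  "poly_subst y p = (\<Sum>\<alpha>\<in>Poly_Mapping.keys p. cst (Poly_Mapping.lookup p \<alpha>) * (\<Prod>i\<in>UNIV. y i ^ Poly_Mapping.lookup \<alpha> i))"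

lemma poly_subst_single: "poly_subst y (Poly_Mapping.single \<alpha> c) = cst c * (\<Prod>i\<in>UNIV. y i ^ Poly_Mapping.lookup \<alpha> i)"
  by (simp add: poly_subst_def)

lemma poly_subst_zero [simp]: "poly_subst y 0 = 0" by (simp add: poly_subst_def)

lemma poly_subst_add: "poly_subst y (p + q) = poly_subst y p + poly_subst y q"
  unfolding poly_subst_def by (rule setsum_keys_plus_distrib) (auto simp: single_add algebra_simps)

lemma poly_subst_mult: "poly_subst y (p * q) = poly_subst y p * poly_subst y q"
proof (induction p rule: poly_mapping_add_induct)
  case (single \<alpha> c)
  show ?case
  proof (induction q rule: poly_mapping_add_induct)
    case (single \<beta> d)
    have "poly_subst y (Poly_Mapping.single (\<alpha> + \<beta>) (c * d)) =
        cst (c * d) * (\<Prod>i\<in>UNIV. y i ^ Poly_Mapping.lookup \<alpha> i) * (\<Prod>i\<in>UNIV. y i ^ Poly_Mapping.lookup \<beta> i)"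
      by (simp only: poly_subst_single lookup_add power_add prod.distrib mult.assoc)
    also have "\<dots> = poly_subst y (Poly_Mapping.single \<alpha> c) * poly_subst y (Poly_Mapping.single \<beta> d)"
      by (simp only: poly_subst_single cst_mult ac_simps)
    finally show ?case by (simp only: mult_single)
  qed (simp_all add: poly_subst_add distrib_left)
qed (simp_all add: poly_subst_add algebra_simps)

lemma poly_subst_cst [simp]: "poly_subst y (cst c) = cst c"
  by (simp add: poly_subst_single)

lemma poly_subst_var [simp]: "poly_subst y (var j) = y j"
proof -
  have "y i ^ Poly_Mapping.lookup (Poly_Mapping.single j 1) i = (if i = j then y j else 1)" for i
    by (simp add: lookup_single when_def)
  thus ?thesis by (simp add: var_def poly_subst_single)
qed

lemma poly_subst_sum: "poly_subst y (sum g A) = (\<Sum>a\<in>A. poly_subst y (g a))"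
  by (induction A rule: infinite_finite_induct) (simp_all add: poly_subst_add)

lemma supp_deg_le_iff: "supp_deg p \<le> m \<longleftrightarrow> (\<forall>\<alpha>\<in>Poly_Mapping.keys p. mdeg \<alpha> \<le> m)"
  by (auto simp: supp_deg_def)

lemma mdeg_unit: "mdeg (Poly_Mapping.single i 1) = 1" "mdeg 0 = 0"
  by (simp_all add: mdeg_def lookup_single when_def)

text \<open>
  The coefficients are of arbitrary type because this serves twice: for polynomials, where it exhibits
  affine forms, and for normal forms, where it exhibits the operators of order at most one.
\<close>

lemma supp_deg_le_1_expansion:
  fixes p :: "'n::finite mindex \<Rightarrow>\<^sub>0 'b::comm_monoid_add"
  assumes "supp_deg p \<le> 1"
  shows "p = Poly_Mapping.single 0 (Poly_Mapping.lookup p 0) +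
    (\<Sum>i\<in>UNIV. Poly_Mapping.single (Poly_Mapping.single i 1) (Poly_Mapping.lookup p (Poly_Mapping.single i 1)))"
    (is "p = ?r")
proof (rule poly_mapping_eqI)
  fix \<alpha> :: "'n mindex"
  let ?e = "\<lambda>i. Poly_Mapping.single i (1::nat)"
  have inj: "?e i = ?e j \<longleftrightarrow> i = j" for i j :: 'n
    by (metis lookup_single_eq lookup_single_not_eq zero_neq_one)
  have nz: "?e i \<noteq> 0" for i :: 'n
    by (metis lookup_single_eq lookup_zero zero_neq_one)
  have r: "Poly_Mapping.lookup ?r \<alpha> = (Poly_Mapping.lookup p 0 when \<alpha> = 0) +
      (\<Sum>i\<in>UNIV. Poly_Mapping.lookup p (?e i) when \<alpha> = ?e i)"
    by (simp add: lookup_add lookup_sum lookup_single eq_commute[of _ \<alpha>])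
  consider "\<alpha> = 0" | j where "\<alpha> = ?e j" | "mdeg \<alpha> > 1"
  proof (cases "mdeg \<alpha>" "1 :: nat" rule: linorder_cases)
    case less
    hence "\<alpha> = 0" by (intro poly_mapping_eqI) (simp add: mdeg_def)
    thus ?thesis using that by blast
  next
    case equal
    hence "(\<Sum>i\<in>UNIV. Poly_Mapping.lookup \<alpha> i) = 1" by (simp add: mdeg_def)
    then obtain j where j: "Poly_Mapping.lookup \<alpha> j = 1" "\<And>i. i \<noteq> j \<Longrightarrow> Poly_Mapping.lookup \<alpha> i = 0"
      using sum_eq_1_iff[of UNIV "Poly_Mapping.lookup \<alpha>"] by auto
    hence "\<alpha> = ?e j" by (intro poly_mapping_eqI) (auto simp: lookup_single when_def)
    thus ?thesis using that by blast
  qed (use that in blast)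
  thus "Poly_Mapping.lookup p \<alpha> = Poly_Mapping.lookup ?r \<alpha>"
  proof cases
    case 1
    thus ?thesis unfolding r using nz by (simp add: when_def nz[symmetric])
  next
    case (2 j)
    thus ?thesis unfolding r using nz[of j] inj by (simp add: when_def)
  next
    case 3
    have "\<alpha> \<notin> Poly_Mapping.keys p"
      using 3 assms unfolding supp_deg_le_iff by force
    moreover have "\<alpha> \<noteq> 0" using 3 by (auto simp: mdeg_unit)
    moreover have "\<alpha> \<noteq> ?e i" for i using 3 mdeg_unit(1)[of i] by auto
    ultimately show ?thesis unfolding r by (simp add: in_keys_iff)
  qed
qed

lemma affine_if_total_degree_le_1:
  fixes p :: "'n::{finite,linorder} cpoly"
  assumes "total_degree p \<le> 1"
  shows "p = cst (Poly_Mapping.lookup p 0)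
    + (\<Sum>i\<in>UNIV. cst (Poly_Mapping.lookup p (Poly_Mapping.single i 1)) * var i)"
  using supp_deg_le_1_expansion[OF assms] by (simp add: var_def mult_single)

section \<open>Left ideals and operators of order one\<close>

lemma wpoly_zero [simp]: "wpoly 0 = (0 :: 'n::{finite,linorder} weyl)"
  using wpoly_add[of 0 0] by simp

lemma wpoly_uminus: "wpoly (- a) = - wpoly (a :: 'n::{finite,linorder} cpoly)"
  using wpoly_add[of a "- a"] by (simp add: eq_neg_iff_add_eq_0 add.commute)

lemma wpoly_sum: "wpoly (sum g A) = (\<Sum>a\<in>A. wpoly (g a :: 'n::{finite,linorder} cpoly))"
  by (induction A rule: infinite_finite_induct) (simp_all add: wpoly_add)

lemma wpoly_commute: "wpoly a * wpoly b = wpoly b * wpoly (a :: 'n::{finite,linorder} cpoly)"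
  by (simp add: mult.commute flip: wpoly_mult)

lemma wpoly_of_nat: "wpoly (of_nat m) = (of_nat m :: 'n::{finite,linorder} weyl)"
  by (induction m) (simp_all add: wpoly_add wpoly_one)

lemma of_nat_cpoly: "(of_nat m :: 'n::{finite,linorder} cpoly) = cst (of_nat m)"
  by (induction m) (simp_all add: single_add flip: single_one)

lemma of_nat_weyl: "(of_nat m :: 'n::{finite,linorder} weyl) = wpoly (cst (of_nat m))"
  by (simp add: wpoly_of_nat flip: of_nat_cpoly)

lemma act_zero_left [simp]: "act 0 r = 0"
  by (simp add: act_def zero_weyl.rep_eq)

lemma act_zero [simp]: "act P 0 = 0"
  by (simp add: act_def)

lemma act_uminus_left: "act (- P) r = - act P r"
  using act_add_left[of P "- P" r] by (simp add: eq_neg_iff_add_eq_0 add.commute)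

lemma act_diff_left: "act (P - Q) r = act P r - act Q r"
  using act_add_left[of P "- Q" r] by (simp add: act_uminus_left)

lemma act_sum_left: "act (\<Sum>a\<in>A. g a) r = (\<Sum>a\<in>A. act (g a) r)"
  by (induction A rule: infinite_finite_induct) (simp_all add: act_add_left)

lemma act_sum: "act P (\<Sum>a\<in>A. g a) = (\<Sum>a\<in>A. act P (g a))"
  by (induction A rule: infinite_finite_induct) (simp_all add: act_add)

lemma left_ideal_zero: "left_ideal I \<Longrightarrow> 0 \<in> I"
  and left_ideal_add: "left_ideal I \<Longrightarrow> x \<in> I \<Longrightarrow> y \<in> I \<Longrightarrow> x + y \<in> I"
  and left_ideal_mult: "left_ideal I \<Longrightarrow> x \<in> I \<Longrightarrow> r * x \<in> I"
  by (auto simp: left_ideal_def)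

lemma left_ideal_uminus: "left_ideal I \<Longrightarrow> x \<in> I \<Longrightarrow> - x \<in> I"
  using left_ideal_mult[of I x "- 1"] by simp

lemma left_ideal_diff: "left_ideal I \<Longrightarrow> x \<in> I \<Longrightarrow> y \<in> I \<Longrightarrow> x - y \<in> I"
  using left_ideal_add[of I x "- y"] left_ideal_uminus[of I y] by simp

lemma left_ideal_sum: "left_ideal I \<Longrightarrow> (\<And>a. a \<in> A \<Longrightarrow> g a \<in> I) \<Longrightarrow> sum g A \<in> I"
  by (induction A rule: infinite_finite_induct) (auto intro: left_ideal_zero left_ideal_add)

lemma left_ideal_hull: "left_ideal (left_ideal hull S)"
  by (rule hull_in) (auto simp: left_ideal_def)

lemma left_ideal_ann: "left_ideal (ann r)"
  by (auto simp: left_ideal_def ann_def act_add_left act_mult)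

definition vfield :: "('n::{finite,linorder} \<Rightarrow> 'n cpoly) \<Rightarrow> 'n weyl" where
  "vfield b = (\<Sum>i\<in>UNIV. wpoly (b i) * wd i)"

definition lie :: "('n::{finite,linorder} \<Rightarrow> 'n cpoly) \<Rightarrow> 'n cpoly \<Rightarrow> 'n cpoly" where
  "lie b p = (\<Sum>i\<in>UNIV. b i * pd i p)"

lemma lie_mult: "lie b (p * q) = lie b p * q + p * lie b q"
  by (simp add: lie_def pd_mult distrib_left distrib_right sum.distrib sum_distrib_left sum_distrib_right ac_simps)

lemma lie_one [simp]: "lie b 1 = 0"
  by (simp add: lie_def)

text \<open>
  The logarithmic derivative of a product is the sum of those of the factors: a vector field that
  scales every factor scales the product.
\<close>

lemma lie_prod:
  assumes "finite A" "\<And>s. s \<in> A \<Longrightarrow> lie b (L s) = a s * L s"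
  shows "lie b (\<Prod>s\<in>A. L s) = (\<Sum>s\<in>A. a s) * (\<Prod>s\<in>A. L s)"
  using assms by (induction A rule: finite_induct) (simp_all add: lie_mult algebra_simps)

lemma vfield_wpoly: "vfield b * wpoly p = wpoly p * vfield b + wpoly (lie b p)"
proof -
  have "vfield b * wpoly p = (\<Sum>i\<in>UNIV. wpoly (b i) * (wpoly p * wd i + wpoly (pd i p)))"
    by (simp only: vfield_def sum_distrib_right mult.assoc wd_wpoly)
  also have "\<dots> = (\<Sum>i\<in>UNIV. wpoly p * (wpoly (b i) * wd i)) + (\<Sum>i\<in>UNIV. wpoly (b i) * wpoly (pd i p))"
    by (simp add: distrib_left sum.distrib wpoly_commute[of _ p] flip: mult.assoc)
  finally show ?thesis
    by (simp add: vfield_def lie_def sum_distrib_left wpoly_sum wpoly_mult)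
qed

lemma wpoly_vfield: "wpoly a * vfield b = vfield (\<lambda>i. a * b i)"
  by (simp add: vfield_def sum_distrib_left wpoly_mult mult.assoc)

lemma vfield_sum: "(\<Sum>k\<in>K. vfield (b k)) = vfield (\<lambda>i. \<Sum>k\<in>K. b k i)"
  unfolding vfield_def wpoly_sum sum_distrib_right by (rule sum.swap)

lemma Fract_sum:
  fixes c :: "'a::idom"
  assumes "c \<noteq> 0" "finite A"
  shows "Fract (\<Sum>a\<in>A. g a) c = (\<Sum>a\<in>A. Fract (g a) c)"
  using assms(2)
proof (induction A rule: finite_induct)
  case empty
  show ?case by (simp add: Zero_fract_def eq_fract assms)
next
  case (insert a A)
  have "Fract (g a + sum g A) c = Fract (g a) c + Fract (sum g A) c"
    using assms(1) by (simp add: eq_fract algebra_simps)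
  thus ?case using insert by simp
qed

text \<open>
  Thus \<open>\<theta> + a\<close> kills \<open>1/f\<close> exactly when \<open>\<theta>(f) = a f\<close>: the operators of order one in the annihilator
  are the vector fields tangent to the arrangement, with \<open>a\<close> determined by the field.
\<close>

lemma act_first_order:
  assumes "f \<noteq> 0"
  shows "act (vfield b + wpoly a) (Fract 1 f) = Fract (a * f - lie b f) (f * f)"
proof -
  have "act (vfield b) (Fract 1 f) = (\<Sum>i\<in>UNIV. Fract (b i * - pd i f) (f * f))"
    using assms by (simp add: vfield_def act_sum_left act_mult act_wpoly act_wd fpd_Fract)
  also have "\<dots> = Fract (\<Sum>i\<in>UNIV. b i * - pd i f) (f * f)"
    using assms by (intro Fract_sum[symmetric]) simp_all
  also have "(\<Sum>i\<in>UNIV. b i * - pd i f) = - lie b f"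
    by (simp add: lie_def sum_negf)
  finally show ?thesis
    using assms by (simp add: act_add_left act_wpoly eq_fract algebra_simps)
qed

lemma weyl_coeffs_first_order:
  "weyl_coeffs (vfield b + wpoly a) =
     Poly_Mapping.single 0 a + (\<Sum>i\<in>UNIV. Poly_Mapping.single (Poly_Mapping.single i 1) (b i))"
proof -
  have s: "weyl_coeffs (\<Sum>i\<in>A. g i) = (\<Sum>i\<in>A. weyl_coeffs (g i))" for A and g :: "'a \<Rightarrow> 'a weyl"
    by (induction A rule: infinite_finite_induct) (simp_all add: zero_weyl.rep_eq plus_weyl.rep_eq)
  have "weyl_coeffs (wpoly c * wd i) = Poly_Mapping.single (Poly_Mapping.single i 1) c" for c :: "'a cpoly" and i
    by (simp add: times_weyl.rep_eq weyl_coeffs_wd nf.ev_single)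
  thus ?thesis
    by (simp add: vfield_def plus_weyl.rep_eq s add.commute)
qed

lemma weyl_order_le_1_iff: "weyl_order P \<le> 1 \<longleftrightarrow> (\<exists>b a. P = vfield b + wpoly a)"
proof
  assume "weyl_order P \<le> 1"
  from supp_deg_le_1_expansion[OF this[unfolded weyl_order_def]]
  show "\<exists>b a. P = vfield b + wpoly a"
    by (intro exI weyl_eqI) (simp only: weyl_coeffs_first_order)
next
  assume "\<exists>b a. P = vfield b + wpoly a"
  then obtain b a where P: "P = vfield b + wpoly a" by blast
  have "mdeg \<alpha> \<le> 1" if "\<alpha> \<in> Poly_Mapping.keys (weyl_coeffs P)" for \<alpha>
  proof (rule ccontr)
    assume "\<not> mdeg \<alpha> \<le> 1"
    hence "\<alpha> \<noteq> 0" "Poly_Mapping.single i (Suc 0) \<noteq> \<alpha>" for i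
      using mdeg_unit(1)[of i] by (auto simp: mdeg_unit(2))
    hence "Poly_Mapping.lookup (weyl_coeffs P) \<alpha> = 0"
      unfolding P weyl_coeffs_first_order by (simp add: lookup_add lookup_sum lookup_single)
    thus False using that by (simp add: in_keys_iff)
  qed
  thus "weyl_order P \<le> 1" by (simp add: weyl_order_def supp_deg_le_iff)
qed

definition order_one_ideal :: "'n::{finite,linorder} cpoly fract \<Rightarrow> 'n weyl set" where
  "order_one_ideal r = left_ideal hull {P. weyl_order P = 1 \<and> act P r = 0}"

lemma left_ideal_order_one_ideal: "left_ideal (order_one_ideal r)"
  unfolding order_one_ideal_def by (rule left_ideal_hull)

lemma order_one_ideal_subset_ann: "order_one_ideal r \<subseteq> ann r"
  unfolding order_one_ideal_def by (rule hull_minimal) (use left_ideal_ann[of r] in \<open>auto simp: ann_def\<close>)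

text \<open>
  The ideal is generated by operators of order exactly one. An operator \<open>\<theta> + a\<close> of order zero is a
  polynomial, and a polynomial that kills a nonzero fraction is zero.
\<close>

lemma first_order_in_order_one_ideal:
  assumes "act (vfield b + wpoly a) r = 0" "r \<noteq> 0"
  shows "vfield b + wpoly a \<in> order_one_ideal r" (is "?P \<in> _")
proof (cases "weyl_order ?P = 1")
  case True
  thus ?thesis unfolding order_one_ideal_def using assms by (intro hull_inc) auto
next
  case False
  hence "weyl_order ?P = 0" using weyl_order_le_1_iff[of ?P] by force
  hence k: "\<forall>\<alpha>\<in>Poly_Mapping.keys (weyl_coeffs ?P). mdeg \<alpha> \<le> 0"
    unfolding weyl_order_def by (metis le_refl supp_deg_le_iff)
  have "\<alpha> = 0" if "\<alpha> \<in> Poly_Mapping.keys (weyl_coeffs ?P)" for \<alpha>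
    using k that by (intro poly_mapping_eqI) (simp add: mdeg_def)
  hence "weyl_coeffs ?P = weyl_coeffs (wpoly (Poly_Mapping.lookup (weyl_coeffs ?P) 0))"
    by (intro poly_mapping_eqI[where 'b = "'a cpoly"]) (auto simp: lookup_single when_def in_keys_iff)
  then obtain q where q: "?P = wpoly q" by (meson weyl_eqI)
  hence "Fract q 1 * r = 0" using assms(1) by (simp add: act_wpoly)
  hence "Fract q 1 = 0" using assms(2) by simp
  hence "q = 0" by (simp add: Zero_fract_def eq_fract)
  thus ?thesis unfolding q by (simp add: left_ideal_zero left_ideal_order_one_ideal)
qed

text \<open>
  If \<open>\<theta> + a\<close> kills \<open>1/g\<close>, then \<open>(\<theta> + a) l\<close> kills \<open>1/(l g)\<close>, and it has order at most one again
  because \<open>\<theta> l = l \<theta> + \<theta>(l)\<close>.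
\<close>

lemma order_one_ideal_mult_linear:
  assumes "g \<noteq> 0" "l \<noteq> 0" "P \<in> order_one_ideal (Fract 1 g)"
  shows "P * wpoly l \<in> order_one_ideal (Fract 1 (l * g))"
proof -
  let ?I = "order_one_ideal (Fract 1 (l * g))"
  note li = left_ideal_order_one_ideal[of "Fract 1 (l * g)"]
  have "order_one_ideal (Fract 1 g) \<subseteq> {P. P * wpoly l \<in> ?I}"
    unfolding order_one_ideal_def[of "Fract 1 g"]
  proof (rule hull_minimal)
    show "left_ideal {P. P * wpoly l \<in> ?I}"
      using li unfolding left_ideal_def by (auto simp: distrib_right mult.assoc)
    show "{P. weyl_order P = 1 \<and> act P (Fract 1 g) = 0} \<subseteq> {P. P * wpoly l \<in> ?I}"
    proof safe
      fix P :: "'a weyl" assume P: "weyl_order P = 1" "act P (Fract 1 g) = 0"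
      then obtain b a where Pba: "P = vfield b + wpoly a" using weyl_order_le_1_iff[of P] by auto
      have eq: "P * wpoly l = vfield (\<lambda>i. l * b i) + wpoly (lie b l + a * l)"
        by (simp add: Pba distrib_right vfield_wpoly wpoly_vfield wpoly_mult wpoly_add add.assoc)
      have "Fract l 1 * Fract 1 (l * g) = Fract 1 g"
        using assms by (simp add: eq_fract)
      hence "act (P * wpoly l) (Fract 1 (l * g)) = 0"
        using P(2) by (simp add: act_mult act_wpoly)
      thus "P * wpoly l \<in> ?I"
        unfolding eq using assms by (intro first_order_in_order_one_ideal) (auto simp: Zero_fract_def eq_fract)
    qed
  qed
  thus ?thesis using assms(3) by blast
qed

section \<open>The order filtration of the Weyl algebra\<close>

text \<open>
  \<open>fil m\<close> consists of the operators of order at most \<open>m\<close>. The recursive form, with the derivatives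
  on the right, reduces each statement about commutators to a short induction on \<open>m\<close>.
\<close>

primrec fil :: "nat \<Rightarrow> 'n::{finite,linorder} weyl set" where
  "fil 0 = range wpoly"
| "fil (Suc m) = {A + (\<Sum>i\<in>UNIV. B i * wd i) | A B. A \<in> fil m \<and> (\<forall>i. B i \<in> fil m)}"

lemma fil_SucI: "A \<in> fil m \<Longrightarrow> (\<And>i. B i \<in> fil m) \<Longrightarrow> A + (\<Sum>i\<in>UNIV. B i * wd i) \<in> fil (Suc m)"
  by auto

lemma fil_zero [simp]: "0 \<in> fil m"
proof (induction m)
  case 0
  show ?case using wpoly_zero by (metis fil.simps(1) rangeI)
next
  case (Suc m)
  show ?case using fil_SucI[OF Suc, of "\<lambda>_. 0"] Suc by simp
qed

lemma fil_add: "P \<in> fil m \<Longrightarrow> Q \<in> fil m \<Longrightarrow> P + Q \<in> fil m"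
proof (induction m arbitrary: P Q)
  case 0
  thus ?case by (auto simp flip: wpoly_add)
next
  case (Suc m)
  then obtain A B A' B' where PQ: "P = A + (\<Sum>i\<in>UNIV. B i * wd i)" "Q = A' + (\<Sum>i\<in>UNIV. B' i * wd i)"
    and AB: "A \<in> fil m" "A' \<in> fil m" "\<And>i. B i \<in> fil m" "\<And>i. B' i \<in> fil m"
    by auto
  have "P + Q = (A + A') + (\<Sum>i\<in>UNIV. (B i + B' i) * wd i)"
    by (simp add: PQ distrib_right sum.distrib)
  thus ?case using fil_SucI[of "A + A'" m "\<lambda>i. B i + B' i"] Suc.IH AB by simp
qed

lemma fil_wpoly_mult: "P \<in> fil m \<Longrightarrow> wpoly a * P \<in> fil m"
proof (induction m arbitrary: P)
  case 0
  thus ?case by (auto simp flip: wpoly_mult)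
next
  case (Suc m)
  then obtain A B where P: "P = A + (\<Sum>i\<in>UNIV. B i * wd i)"
    and AB: "A \<in> fil m" "\<And>i. B i \<in> fil m"
    by auto
  have "wpoly a * P = wpoly a * A + (\<Sum>i\<in>UNIV. (wpoly a * B i) * wd i)"
    by (simp add: P distrib_left sum_distrib_left mult.assoc)
  thus ?case using fil_SucI[of "wpoly a * A" m "\<lambda>i. wpoly a * B i"] Suc.IH AB by simp
qed

lemma fil_uminus: "P \<in> fil m \<Longrightarrow> - P \<in> fil m"
  using fil_wpoly_mult[of P m "- 1"] by (simp add: wpoly_uminus wpoly_one)

lemma fil_diff: "P \<in> fil m \<Longrightarrow> Q \<in> fil m \<Longrightarrow> P - Q \<in> fil m"
  using fil_add[of P m "- Q"] fil_uminus[of Q] by simp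

lemma fil_sum: "(\<And>a. a \<in> A \<Longrightarrow> g a \<in> fil m) \<Longrightarrow> sum g A \<in> fil m"
  by (induction A rule: infinite_finite_induct) (auto intro: fil_add)

lemma fil_of_nat_mult: "P \<in> fil m \<Longrightarrow> of_nat k * P \<in> fil m"
  using fil_wpoly_mult[of P m "of_nat k"] by (simp add: wpoly_of_nat)

lemma fil_Suc: "P \<in> fil m \<Longrightarrow> P \<in> fil (Suc m)"
  using fil_SucI[of P m "\<lambda>_. 0"] by simp

lemma fil_wd_right: "P \<in> fil m \<Longrightarrow> P * wd j \<in> fil (Suc m)"
proof -
  assume P: "P \<in> fil m"
  have "P * wd j = 0 + (\<Sum>i\<in>UNIV. (if i = j then P else 0) * wd i)"
    by (simp add: if_distrib[of "\<lambda>x. x * _"] cong: if_cong)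
  also have "\<dots> \<in> fil (Suc m)" using P by (intro fil_SucI) auto
  finally show ?thesis .
qed

lemma commutator_wd: "P \<in> fil m \<Longrightarrow> wd j * P - P * wd j \<in> fil m"
proof (induction m arbitrary: P)
  case 0
  thus ?case by (auto simp: wd_wpoly)
next
  case (Suc m)
  then obtain A B where P: "P = A + (\<Sum>i\<in>UNIV. B i * wd i)"
    and AB: "A \<in> fil m" "\<And>i. B i \<in> fil m"
    by auto
  have "wd j * P - P * wd j = (wd j * A - A * wd j) + (\<Sum>i\<in>UNIV. (wd j * B i - B i * wd j) * wd i)"
    by (simp add: P algebra_simps sum_distrib_left sum_distrib_right sum_subtractf wd_commute[of _ j])
  thus ?case
    using fil_SucI[of "wd j * A - A * wd j" m "\<lambda>i. wd j * B i - B i * wd j"] Suc.IH AB by simp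
qed

lemma fil_wd_left: "P \<in> fil m \<Longrightarrow> wd j * P \<in> fil (Suc m)"
  using fil_add[OF fil_Suc[OF commutator_wd[of P m j]] fil_wd_right[of P m j]] by simp

lemma fil_exhaustive: "\<exists>m. P \<in> fil m"
proof -
  have mono: "m \<le> m' \<Longrightarrow> P \<in> fil m \<Longrightarrow> P \<in> fil m'" for m m' and P :: "'a weyl"
    by (induction m' rule: dec_induct) (auto intro: fil_Suc simp del: fil.simps)
  have add: "\<exists>m. P + Q \<in> fil m" if "\<exists>m. P \<in> fil m" "\<exists>m. Q \<in> fil m" for P Q :: "'a weyl"
    using that mono fil_add by (metis max.cobounded1 max.cobounded2)
  have pow: "\<exists>m. ((*) (wd i) ^^ k) Q \<in> fil m" if "\<exists>m. Q \<in> fil m" for i k and Q :: "'a weyl"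
    using that by (induction k) (auto intro: fil_wd_left simp del: fil.simps)
  have one: "\<exists>m. (1 :: 'a weyl) \<in> fil m"
    by (metis fil.simps(1) rangeI wpoly_one)
  have "\<exists>m. foldr (\<lambda>i h. ((*) (wd i) ^^ Poly_Mapping.lookup \<alpha> i) \<circ> h) xs id (1 :: 'a weyl) \<in> fil m" for xs \<alpha>
    by (induction xs) (auto intro: pow one simp del: fil.simps)
  hence "\<exists>m. wpoly a * mpow (\<lambda>i. (*) (wd i)) \<alpha> (1 :: 'a weyl) \<in> fil m" for a \<alpha>
    unfolding mpow_def using fil_wpoly_mult by blast
  hence "\<exists>m. (\<Sum>\<alpha>\<in>A. wpoly (c \<alpha>) * mpow (\<lambda>i. (*) (wd i)) \<alpha> (1 :: 'a weyl)) \<in> fil m" for A c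
    by (induction A rule: infinite_finite_induct) (auto intro: add fil_zero simp del: fil.simps)
  thus ?thesis by (subst weyl_normal_form)
qed

lemma fil_wpoly_right: "P \<in> fil m \<Longrightarrow> P * wpoly q \<in> fil m"
proof (induction m arbitrary: P q)
  case 0
  thus ?case by (auto simp flip: wpoly_mult)
next
  case (Suc m)
  then obtain A B where P: "P = A + (\<Sum>i\<in>UNIV. B i * wd i)"
    and AB: "A \<in> fil m" "\<And>i. B i \<in> fil m"
    by auto
  have "P * wpoly q = (A * wpoly q + (\<Sum>i\<in>UNIV. B i * wpoly (pd i q)))
      + (\<Sum>i\<in>UNIV. (B i * wpoly q) * wd i)"
    by (simp add: P distrib_left distrib_right sum_distrib_right sum.distrib wd_wpoly mult.assoc)
  thus ?case
    using fil_SucI[of "A * wpoly q + (\<Sum>i\<in>UNIV. B i * wpoly (pd i q))" m "\<lambda>i. B i * wpoly q"]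
      Suc.IH AB by (simp add: fil_add fil_sum del: fil.simps)
qed

lemma commutator_wpoly: "P \<in> fil (Suc m) \<Longrightarrow> P * wpoly q - wpoly q * P \<in> fil m"
proof (induction m arbitrary: P)
  case (0 P)
  then obtain A B where P: "P = A + (\<Sum>i\<in>UNIV. B i * wd i)"
    and AB: "A \<in> fil 0" "\<And>i. B i \<in> fil 0"
    by auto
  have c: "wpoly q * Q = Q * wpoly q" if "Q \<in> fil 0" for Q
    using that by (auto simp: wpoly_commute)
  have c': "wpoly q * (B i * wd i) = B i * (wpoly q * wd i)" for i
    using c[OF AB(2)] by (simp flip: mult.assoc)
  have "P * wpoly q - wpoly q * P = (\<Sum>i\<in>UNIV. B i * wpoly (pd i q))"
    by (simp add: P c[OF AB(1)] c' distrib_left distrib_right sum_distrib_left sum_distrib_right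
        sum.distrib wd_wpoly mult.assoc)
  thus ?case using AB(2) by (simp add: fil_sum fil_wpoly_right del: fil.simps)
next
  case (Suc m)
  from Suc.prems obtain A B where P: "P = A + (\<Sum>i\<in>UNIV. B i * wd i)"
    and AB: "A \<in> fil (Suc m)" "\<And>i. B i \<in> fil (Suc m)"
    unfolding fil.simps(2)[of "Suc m"] by blast
  have "P * wpoly q - wpoly q * P =
      ((A * wpoly q - wpoly q * A) + (\<Sum>i\<in>UNIV. B i * wpoly (pd i q)))
      + (\<Sum>i\<in>UNIV. (B i * wpoly q - wpoly q * B i) * wd i)"
    by (simp add: P distrib_left distrib_right left_diff_distrib sum_distrib_left sum_distrib_right
        sum_subtractf sum.distrib wd_wpoly mult.assoc)
  moreover have "(A * wpoly q - wpoly q * A) + (\<Sum>i\<in>UNIV. B i * wpoly (pd i q)) \<in> fil (Suc m)"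
    by (intro fil_add fil_sum fil_wpoly_right fil_Suc[OF Suc.IH] AB)
  moreover have "B i * wpoly q - wpoly q * B i \<in> fil m" for i
    using AB Suc.IH by blast
  ultimately show ?case
    by (simp only: fil_add fil_sum fil_wd_right)
qed

text \<open>
  Euler's identity for the symbol of \<open>P\<close>: the symbol of \<open>[P, x\<^sub>j]\<close> is the partial derivative of the
  symbol of \<open>P\<close> with respect to the variable dual to \<open>x\<^sub>j\<close>. It recovers \<open>P\<close>, up to lower order, from its
  commutators with the coordinates.
\<close>

lemma symbol_euler:
  "P \<in> fil (Suc m) \<Longrightarrow>
    of_nat (Suc m) * P - (\<Sum>j\<in>UNIV. (P * wpoly (var j) - wpoly (var j) * P) * wd j) \<in> fil m"
proof (induction m arbitrary: P)
  case (0 P)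
  then obtain A B where P: "P = A + (\<Sum>i\<in>UNIV. B i * wd i)"
    and AB: "A \<in> fil 0" "\<And>i. B i \<in> fil 0"
    by auto
  have c: "wpoly q * Q = Q * wpoly q" if "Q \<in> fil 0" for Q q
    using that by (auto simp: wpoly_commute)
  have c': "wpoly q * (B i * wd i) = B i * (wpoly q * wd i)" for i q
    using c[OF AB(2)] by (simp flip: mult.assoc)
  have "P * wpoly (var j) - wpoly (var j) * P = B j" for j
    by (simp add: P c[OF AB(1)] c' distrib_left distrib_right sum_distrib_left sum_distrib_right
        sum.distrib wd_wpoly mult.assoc pd_var if_distrib[of wpoly] if_distrib[of "\<lambda>x. _ * x"] wpoly_one
        cong: if_cong)
  thus ?case using AB by (simp add: P del: fil.simps)
next
  case (Suc m)
  let ?c = "\<lambda>P j. P * wpoly (var j) - wpoly (var j) * P"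
  from Suc.prems obtain A B where P: "P = A + (\<Sum>i\<in>UNIV. B i * wd i)"
    and AB: "A \<in> fil (Suc m)" "\<And>i. B i \<in> fil (Suc m)"
    unfolding fil.simps(2)[of "Suc m"] by blast
  define A' where "A' = of_nat (Suc (Suc m)) * A - (\<Sum>j\<in>UNIV. ?c A j * wd j)"
  define B' where "B' = (\<lambda>i. of_nat (Suc m) * B i - (\<Sum>j\<in>UNIV. ?c (B i) j * wd j))"
  have c: "?c P j = ?c A j + B j + (\<Sum>i\<in>UNIV. ?c (B i) j * wd i)" for j
  proof -
    have "?c P j = ?c A j + (\<Sum>i\<in>UNIV. B i * wpoly (pd i (var j))) + (\<Sum>i\<in>UNIV. ?c (B i) j * wd i)"
      by (simp add: P distrib_left distrib_right left_diff_distrib sum_distrib_left sum_distrib_right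
        sum_subtractf sum.distrib wd_wpoly mult.assoc)
    also have "(\<Sum>i\<in>UNIV. B i * wpoly (pd i (var j))) = B j"
      by (simp add: pd_var if_distrib[of wpoly] if_distrib[of "\<lambda>x. _ * x"] wpoly_one cong: if_cong)
    finally show ?thesis .
  qed
  have sw: "(\<Sum>j\<in>UNIV. (\<Sum>i\<in>UNIV. ?c (B i) j * wd i) * wd j) = (\<Sum>i\<in>UNIV. (\<Sum>j\<in>UNIV. ?c (B i) j * wd j) * wd i)"
    unfolding sum_distrib_right by (subst sum.swap) (simp add: mult.assoc wd_commute)
  have "of_nat (Suc (Suc m)) * P - (\<Sum>j\<in>UNIV. ?c P j * wd j) = A' + (\<Sum>i\<in>UNIV. B' i * wd i)"
    unfolding c distrib_right sum.distrib sw
    by (simp add: P A'_def B'_def distrib_left distrib_right left_diff_distrib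
        sum_subtractf sum.distrib sum_distrib_left mult.assoc)
  moreover have "A' \<in> fil (Suc m)"
    unfolding A'_def using AB(1)
    by (intro fil_diff fil_sum fil_of_nat_mult fil_wd_right commutator_wpoly)
  moreover have "B' i \<in> fil m" for i
    unfolding B'_def using AB(2) by (rule Suc.IH)
  ultimately show ?case
    by (simp only: fil_add fil_sum fil_wd_right)
qed

lemma cst_central: "P * wpoly (cst c) = wpoly (cst c) * (P :: 'n::{finite,linorder} weyl)"
proof -
  obtain m where "P \<in> fil m" using fil_exhaustive by blast
  thus ?thesis
  proof (induction m arbitrary: P)
    case 0
    thus ?case by (auto simp: wpoly_commute)
  next
    case (Suc m)
    then obtain A B where P: "P = A + (\<Sum>i\<in>UNIV. B i * wd i)"
      and AB: "A \<in> fil m" "\<And>i. B i \<in> fil m"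
      by auto
    have "B i * wd i * wpoly (cst c) = wpoly (cst c) * (B i * wd i)" for i
      using Suc.IH[OF AB(2), of i] by (simp add: mult.assoc wd_wpoly) (simp flip: mult.assoc)
    thus ?case
      using Suc.IH[OF AB(1)] by (simp add: P distrib_left distrib_right sum_distrib_left sum_distrib_right)
  qed
qed

lemma left_ideal_of_nat_cancel:
  fixes P :: "'n::{finite,linorder} weyl"
  assumes "left_ideal I" "of_nat m * P \<in> I" "m > 0"
  shows "P \<in> I"
proof -
  have "wpoly (cst (1 / of_nat m)) * (of_nat m :: 'n weyl) = wpoly (cst (1 / of_nat m) * cst (of_nat m))"
    by (simp only: of_nat_weyl wpoly_mult)
  also have "\<dots> = 1"
    using assms(3) by (simp only: cst_mult[symmetric]) (simp add: wpoly_one)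
  finally have "wpoly (cst (1 / of_nat m)) * (of_nat m * P) = P"
    by (simp flip: mult.assoc)
  thus ?thesis using left_ideal_mult[OF assms(1,2)] by metis
qed

definition const_field :: "('n::{finite,linorder} \<Rightarrow> complex) \<Rightarrow> 'n weyl" where
  "const_field w = vfield (\<lambda>i. cst (w i))"

lemma commutator_const_field:
  assumes "Q \<in> fil m"
  shows "const_field w * Q - Q * const_field w \<in> fil m"
proof -
  have "Q * (wpoly (cst (w i)) * wd i) = wpoly (cst (w i)) * (Q * wd i)" for i
    by (simp add: cst_central flip: mult.assoc)
  hence "const_field w * Q - Q * const_field w = (\<Sum>i\<in>UNIV. wpoly (cst (w i)) * (wd i * Q - Q * wd i))"
    by (simp add: const_field_def vfield_def sum_distrib_left sum_distrib_right mult.assoc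
        right_diff_distrib sum_subtractf)
  also have "\<dots> \<in> fil m"
    by (intro fil_sum fil_wpoly_mult commutator_wd assms)
  finally show ?thesis .
qed

section \<open>Powers of independent affine forms\<close>

text \<open>
  The forms may be constant, and they may be equal or proportional to one another.
\<close>

locale affine_forms =
  fixes L :: "'i \<Rightarrow> 'n::{finite,linorder} cpoly"
    and const :: "'i \<Rightarrow> complex" and slope :: "'i \<Rightarrow> 'n \<Rightarrow> complex"
  assumes L_eq: "L s = cst (const s) + (\<Sum>i\<in>UNIV. cst (slope s i) * var i)"
    and L_nonzero: "L s \<noteq> 0"
begin

definition dir_deriv :: "'i \<Rightarrow> ('n \<Rightarrow> complex) \<Rightarrow> complex" where
  "dir_deriv s w = (\<Sum>i\<in>UNIV. slope s i * w i)"

text \<open>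
  A dual system of directions certifies that the linear parts of the forms in \<open>K\<close> are linearly
  independent; it passes to subsets of \<open>K\<close> unchanged.
\<close>

definition dual :: "'i set \<Rightarrow> ('i \<Rightarrow> 'n \<Rightarrow> complex) \<Rightarrow> bool" where
  "dual K v \<longleftrightarrow> (\<forall>j\<in>K. \<forall>k\<in>K. dir_deriv j (v k) = (if j = k then 1 else 0))"

text \<open>
  \<open>L\<^sub>s\<close> made constant along the directions \<open>v\<^sub>k\<close> by subtracting multiples of the \<open>L\<^sub>k\<close>. For a dual
  system it represents the restriction of \<open>L\<^sub>s\<close> to the common zero set of the forms in \<open>K\<close>.
\<close>

definition residual :: "'i set \<Rightarrow> ('i \<Rightarrow> 'n \<Rightarrow> complex) \<Rightarrow> 'i \<Rightarrow> 'n cpoly" where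
  "residual K v s = L s - (\<Sum>k\<in>K. cst (dir_deriv s (v k)) * L k)"

definition pow_ideal :: "'i set \<Rightarrow> ('i \<Rightarrow> nat) \<Rightarrow> 'n cpoly set" where
  "pow_ideal K N = {\<Sum>k\<in>K. b k * L k ^ N k | b. True}"

lemma dual_subset: "dual K v \<Longrightarrow> K' \<subseteq> K \<Longrightarrow> dual K' v"
  unfolding dual_def by (meson subsetD)

lemma pow_idealI: "x = (\<Sum>k\<in>K. b k * L k ^ N k) \<Longrightarrow> x \<in> pow_ideal K N"
  by (auto simp: pow_ideal_def)

lemma pow_idealE:
  assumes "x \<in> pow_ideal K N"
  obtains b where "x = (\<Sum>k\<in>K. b k * L k ^ N k)"
  using assms by (auto simp: pow_ideal_def)

lemma pow_ideal_zero [simp]: "0 \<in> pow_ideal K N"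
  by (rule pow_idealI[where b = "\<lambda>_. 0"]) simp

lemma pow_ideal_add: "x \<in> pow_ideal K N \<Longrightarrow> y \<in> pow_ideal K N \<Longrightarrow> x + y \<in> pow_ideal K N"
  by (elim pow_idealE, rule pow_idealI[where b = "\<lambda>k. _ k + _ k"]) (simp add: sum.distrib distrib_right)

lemma pow_ideal_mult: "x \<in> pow_ideal K N \<Longrightarrow> a * x \<in> pow_ideal K N"
  by (elim pow_idealE, rule pow_idealI[where b = "\<lambda>k. a * _ k"]) (simp add: sum_distrib_left mult.assoc)

lemma pow_ideal_mult_right: "x \<in> pow_ideal K N \<Longrightarrow> x * a \<in> pow_ideal K N"
  using pow_ideal_mult[of x K N a] by (simp add: mult.commute)

lemma pow_ideal_uminus: "x \<in> pow_ideal K N \<Longrightarrow> - x \<in> pow_ideal K N"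
  using pow_ideal_mult[of x K N "- 1"] by simp

lemma pow_ideal_diff: "x \<in> pow_ideal K N \<Longrightarrow> y \<in> pow_ideal K N \<Longrightarrow> x - y \<in> pow_ideal K N"
  using pow_ideal_add[of x K N "- y"] pow_ideal_uminus[of y] by simp

lemma pow_ideal_cong: "(\<And>k. k \<in> K \<Longrightarrow> N k = N' k) \<Longrightarrow> pow_ideal K N = pow_ideal K N'"
  by (simp add: pow_ideal_def)

lemma pow_ideal_remove:
  assumes "finite K" "k \<in> K"
  shows "x \<in> pow_ideal K N \<longleftrightarrow> (\<exists>d\<in>pow_ideal (K - {k}) N. \<exists>e. x = d + e * L k ^ N k)"
proof
  assume "x \<in> pow_ideal K N"
  then obtain b where "x = (\<Sum>k\<in>K. b k * L k ^ N k)" by (rule pow_idealE)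
  hence "x = (\<Sum>k\<in>K - {k}. b k * L k ^ N k) + b k * L k ^ N k"
    using assms by (simp add: sum.remove add.commute)
  thus "\<exists>d\<in>pow_ideal (K - {k}) N. \<exists>e. x = d + e * L k ^ N k"
    by (intro bexI exI pow_idealI) simp_all
next
  assume "\<exists>d\<in>pow_ideal (K - {k}) N. \<exists>e. x = d + e * L k ^ N k"
  then obtain b e where x: "x = (\<Sum>k\<in>K - {k}. b k * L k ^ N k) + e * L k ^ N k"
    by (auto elim: pow_idealE)
  have "(\<Sum>j\<in>K. (b(k := e)) j * L j ^ N j) = x"
    using assms unfolding x by (simp add: sum.remove[of K k] add.commute)
  thus "x \<in> pow_ideal K N" by (metis pow_idealI)
qed

lemma pow_ideal_generator:
  assumes "finite K" "k \<in> K"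
  shows "L k ^ N k \<in> pow_ideal K N"
  unfolding pow_ideal_remove[OF assms] by (intro bexI[of _ 0] exI[of _ 1]) auto

text \<open>
  For a dual system, this is the pullback along the affine projection \<open>x \<mapsto> x - \<Sum>\<^sub>k L\<^sub>k(x) v\<^sub>k\<close> of the
  space onto the common zero set of the forms in \<open>K\<close>. Its kernel is the ideal generated by these forms, which is therefore prime.
\<close>

definition proj :: "'i set \<Rightarrow> ('i \<Rightarrow> 'n \<Rightarrow> complex) \<Rightarrow> 'n cpoly \<Rightarrow> 'n cpoly" where
  "proj K v = poly_subst (\<lambda>i. var i - (\<Sum>k\<in>K. cst (v k i) * L k))"

lemma proj_L: "proj K v (L s) = residual K v s"
proof -
  have "proj K v (L s) = L s - (\<Sum>i\<in>UNIV. cst (slope s i) * (\<Sum>k\<in>K. cst (v k i) * L k))"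
    unfolding proj_def by (subst (1 2) L_eq[of s])
      (simp add: poly_subst_add poly_subst_sum poly_subst_mult right_diff_distrib sum_subtractf)
  also have "(\<Sum>i\<in>UNIV. cst (slope s i) * (\<Sum>k\<in>K. cst (v k i) * L k)) =
      (\<Sum>k\<in>K. (\<Sum>i\<in>UNIV. cst (slope s i * v k i)) * L k)"
    unfolding sum_distrib_left sum_distrib_right by (subst sum.swap) (simp only: cst_mult mult.assoc)
  also have "(\<lambda>k. \<Sum>i\<in>UNIV. cst (slope s i * v k i)) = (\<lambda>k. cst (dir_deriv s (v k)))"
    by (rule ext, rule poly_mapping_eqI, simp add: dir_deriv_def lookup_sum lookup_single when_def)
  finally show ?thesis by (simp add: residual_def)
qed

lemma residual_member:
  assumes "dual K v" "finite K" "s \<in> K"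
  shows "residual K v s = 0"
proof -
  have "(\<Sum>k\<in>K. cst (dir_deriv s (v k)) * L k) = (\<Sum>k\<in>K. if s = k then L k else 0)"
    using assms by (intro sum.cong) (auto simp: dual_def)
  thus ?thesis using assms by (simp add: residual_def)
qed

lemma residual_remove:
  assumes "dual K v" "k \<in> K"
  shows "residual (K - {k}) v k = L k"
proof -
  have "dir_deriv k (v j) = 0" if "j \<in> K - {k}" for j
    using assms that by (auto simp: dual_def)
  thus ?thesis by (simp add: residual_def)
qed

lemma proj_congruent:
  assumes "finite K"
  shows "proj K v p - p \<in> pow_ideal K (\<lambda>_. 1)"
proof (induction p rule: cpoly_induct)
  case (cst c)
  show ?case by (simp add: proj_def)
next
  case (var i)
  have "proj K v (var i) - var i = (\<Sum>k\<in>K. (- cst (v k i)) * L k ^ 1)"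
    by (simp add: proj_def sum_negf)
  thus ?case by (rule pow_idealI)
next
  case (add p q)
  have "proj K v (p + q) - (p + q) = (proj K v p - p) + (proj K v q - q)"
    by (simp add: proj_def poly_subst_add)
  thus ?case using add by (simp only: pow_ideal_add)
next
  case (mult p q)
  have "proj K v (p * q) - p * q = proj K v p * (proj K v q - q) + (proj K v p - p) * q"
    by (simp add: proj_def poly_subst_mult algebra_simps)
  thus ?case using mult by (simp only: pow_ideal_add pow_ideal_mult pow_ideal_mult_right)
qed

lemma proj_pow_ideal:
  assumes "finite K" "dual K v" "x \<in> pow_ideal K (\<lambda>_. 1)"
  shows "proj K v x = 0"
proof -
  from assms(3) obtain b where x: "x = (\<Sum>k\<in>K. b k * L k ^ 1)" by (rule pow_idealE)
  have "proj K v x = (\<Sum>k\<in>K. proj K v (b k) * proj K v (L k))"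
    by (simp add: x proj_def poly_subst_sum poly_subst_mult)
  also have "\<dots> = 0" using assms by (simp add: proj_L residual_member)
  finally show ?thesis .
qed

lemma prime_pow_ideal:
  assumes "finite K" "dual K v" "residual K v s \<noteq> 0" "a * L s \<in> pow_ideal K (\<lambda>_. 1)"
  shows "a \<in> pow_ideal K (\<lambda>_. 1)"
proof -
  have "proj K v a * proj K v (L s) = 0"
    using proj_pow_ideal[OF assms(1,2,4)] by (simp add: proj_def poly_subst_mult)
  hence "proj K v a = 0" using assms by (simp add: proj_L)
  thus ?thesis using pow_ideal_uminus[OF proj_congruent[OF assms(1), of v a]] by simp
qed

lemma pow_ideal_fun_upd_remove [simp]: "pow_ideal (K - {k}) (N(k := n)) = pow_ideal (K - {k}) N"
  by (rule pow_ideal_cong) auto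

lemma nonzerodivisor_power:
  assumes "\<And>a. a * L s \<in> pow_ideal K N \<Longrightarrow> a \<in> pow_ideal K N"
  shows "a * L s ^ n \<in> pow_ideal K N \<Longrightarrow> a \<in> pow_ideal K N"
proof (induction n arbitrary: a)
  case (Suc n)
  thus ?case using assms[of "a * L s ^ n"] by (simp add: mult.assoc mult.commute[of "L s"])
qed simp

text \<open>
  Induction on the sum of the exponents. When all exponents are one the ideal is prime. When some
  \<open>N\<^sub>k = n + 1\<close> with \<open>n > 0\<close>, lowering \<open>N\<^sub>k\<close> to \<open>n\<close> gives \<open>a = b + c L\<^sub>k\<^sup>n\<close> with \<open>b\<close> in the ideal of the
  other powers. Modulo the latter, \<open>L\<^sub>k\<close> is a nonzerodivisor by induction, since \<open>k\<close> is independent of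
  \<open>K - {k}\<close>; cancelling \<open>L\<^sub>k\<^sup>n\<close> shows that \<open>c L\<^sub>s\<close> lies in the ideal with exponent one at \<open>k\<close>, hence so
  does \<open>c\<close>, and \<open>a\<close> lies in the original ideal.
\<close>

lemma nonzerodivisor_pow_ideal:
  assumes "finite K" "dual K v" "residual K v s \<noteq> 0" "a * L s \<in> pow_ideal K N"
  shows "a \<in> pow_ideal K N"
  using assms
proof (induction "\<Sum>k\<in>K. N k" arbitrary: K N s a rule: less_induct)
  case less
  consider "\<And>k. k \<in> K \<Longrightarrow> N k = 1" | k where "k \<in> K" "N k = 0" | k where "k \<in> K" "N k > 1"
    by (meson less_one nat_neq_iff)
  thus ?case
  proof cases
    case 1
    hence "pow_ideal K N = pow_ideal K (\<lambda>_. 1)" by (rule pow_ideal_cong)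
    thus ?thesis using prime_pow_ideal less.prems by simp
  next
    case (2 k)
    thus ?thesis using pow_ideal_mult[OF pow_ideal_generator[of K k N], of a] less.prems(1) by simp
  next
    case (3 k)
    define n where "n = N k - 1"
    have n: "N k = Suc n" "n > 0" using 3(2) by (simp_all add: n_def)
    note rem = pow_ideal_remove[OF less.prems(1) 3(1)]
    have decrease: "(\<Sum>j\<in>K. (N(k := m)) j) < (\<Sum>j\<in>K. N j)" if "m < N k" for m
      using less.prems(1) 3(1) that by (intro sum_strict_mono_ex1) auto
    have decrease': "(\<Sum>j\<in>K - {k}. N j) < (\<Sum>j\<in>K. N j)"
      using less.prems(1) 3 by (simp add: sum.remove[of K k])
    obtain d e where d: "d \<in> pow_ideal (K - {k}) N" and de: "a * L s = d + e * L k ^ Suc n"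
      using less.prems(4) n(1) unfolding rem by auto
    have "a * L s \<in> pow_ideal K (N(k := n))"
      unfolding rem using d by (intro bexI[of _ d] exI[of _ "e * L k"]) (simp_all add: de)
    hence "a \<in> pow_ideal K (N(k := n))"
      using less.hyps[where K = K and N = "N(k := n)", OF decrease less.prems(1-3)] n by simp
    then obtain b c where b: "b \<in> pow_ideal (K - {k}) N" and bc: "a = b + c * L k ^ n"
      unfolding rem by auto
    have nzd: "x \<in> pow_ideal (K - {k}) N" if "x * L k ^ n \<in> pow_ideal (K - {k}) N" for x
    proof (rule nonzerodivisor_power[OF _ that])
      fix x assume x: "x * L k \<in> pow_ideal (K - {k}) N"
      show "x \<in> pow_ideal (K - {k}) N"
        using less.hyps[OF decrease' _ dual_subset[OF less.prems(2)] _ x] less.prems(1)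
          residual_remove[OF less.prems(2) 3(1)] L_nonzero by auto
    qed
    have "(c * L s - e * L k) * L k ^ n = d - b * L s"
      using de unfolding bc by (simp add: algebra_simps)
    also have "\<dots> \<in> pow_ideal (K - {k}) N"
      using b d by (intro pow_ideal_diff pow_ideal_mult_right)
    finally have "c * L s - e * L k \<in> pow_ideal (K - {k}) N" by (rule nzd)
    hence "c * L s \<in> pow_ideal K (N(k := 1))"
      unfolding rem by (intro bexI[of _ "c * L s - e * L k"] exI[of _ e]) auto
    hence "c \<in> pow_ideal K (N(k := 1))"
      using less.hyps[where K = K and N = "N(k := 1)", OF decrease less.prems(1-3)] 3(2) by simp
    then obtain d' e' where d': "d' \<in> pow_ideal (K - {k}) N" and "c = d' + e' * L k"
      unfolding rem by auto
    hence "a = (b + d' * L k ^ n) + e' * L k ^ N k"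
      unfolding bc n by (simp add: algebra_simps)
    moreover have "b + d' * L k ^ n \<in> pow_ideal (K - {k}) N"
      using b d' by (intro pow_ideal_add pow_ideal_mult_right)
    ultimately show ?thesis unfolding rem by blast
  qed
qed

lemma colon_pow_ideal:
  assumes "finite K" "dual K v" "k \<in> K" "N k = Suc m" "q * L k ^ m \<in> pow_ideal K N"
  shows "q \<in> pow_ideal K (N(k := 1))"
proof -
  note rem = pow_ideal_remove[OF assms(1,3)]
  obtain d e where d: "d \<in> pow_ideal (K - {k}) N" and de: "q * L k ^ m = d + e * L k ^ Suc m"
    using assms(4,5) unfolding rem by auto
  have "(q - e * L k) * L k ^ m = d" using de by (simp add: algebra_simps)
  hence "(q - e * L k) * L k ^ m \<in> pow_ideal (K - {k}) N" using d by simp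
  hence "q - e * L k \<in> pow_ideal (K - {k}) N"
  proof (rule nonzerodivisor_power[rotated])
    fix x assume "x * L k \<in> pow_ideal (K - {k}) N"
    thus "x \<in> pow_ideal (K - {k}) N"
      using nonzerodivisor_pow_ideal[OF _ dual_subset[OF assms(2)], of "K - {k}" k x N]
        residual_remove[OF assms(2,3)] L_nonzero assms(1) by auto
  qed
  thus ?thesis unfolding rem by (intro bexI[of _ "q - e * L k"] exI[of _ e]) auto
qed

text \<open>
  The exponents are lowered one form at a time; \<open>T\<close> in the proof is the set of forms already treated.
\<close>

lemma colon_pow_ideal_prod:
  assumes "finite K" "dual K v" "q * (\<Prod>k\<in>K. L k ^ m) \<in> pow_ideal K (\<lambda>_. Suc m)"
  shows "q \<in> pow_ideal K (\<lambda>_. 1)"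
proof -
  have "finite T \<Longrightarrow> T \<subseteq> K \<Longrightarrow> q * (\<Prod>k\<in>K - T. L k ^ m) \<in> pow_ideal K (\<lambda>k. if k \<in> T then 1 else Suc m)" for T
  proof (induction T rule: finite_induct)
    case empty
    show ?case using assms(3) by simp
  next
    case (insert k T)
    let ?N = "\<lambda>k. if k \<in> T then 1 else Suc m"
    have "(\<Prod>k\<in>K - T. L k ^ m) = (\<Prod>k\<in>K - insert k T. L k ^ m) * L k ^ m"
      using insert assms(1) by (subst prod.remove[of _ k]) (auto simp: Diff_insert[symmetric] mult.commute)
    hence "q * (\<Prod>k\<in>K - insert k T. L k ^ m) * L k ^ m \<in> pow_ideal K ?N"
      using insert by (simp add: mult.assoc)
    from colon_pow_ideal[OF assms(1,2) _ _ this] insert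
    have "q * (\<Prod>k\<in>K - insert k T. L k ^ m) \<in> pow_ideal K (?N(k := 1))" by simp
    also have "?N(k := 1) = (\<lambda>j. if j \<in> insert k T then 1 else Suc m)" by auto
    finally show ?case .
  qed
  from this[of K] assms(1) pow_ideal_cong[of K "\<lambda>k. if k \<in> K then 1 else Suc m" "\<lambda>_. 1"]
  show ?thesis by simp
qed

end

section \<open>Fractions whose denominator omits a factor\<close>

lemma localization_common_exponent:
  fixes f :: "'a::idom"
  assumes "f \<noteq> 0" "u \<in> localization f"
  shows "\<exists>M. \<forall>N\<ge>M. \<exists>a. u = Fract a (f ^ N)"
proof -
  from assms(2) obtain a M where u: "u = Fract a (f ^ M)" by (auto simp: localization_def)
  have "u = Fract (a * f ^ (N - M)) (f ^ N)" if "N \<ge> M" for N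
    using that assms(1) by (simp add: u eq_fract mult.assoc flip: power_add)
  thus ?thesis by blast
qed

lemma localization_zero: "0 \<in> localization (f :: 'a::idom)"
  unfolding localization_def Zero_fract_def by (metis (mono_tags, lifting) mem_Collect_eq power_0)

lemma localization_add:
  fixes f :: "'a::idom"
  assumes "f \<noteq> 0" "u \<in> localization f" "w \<in> localization f"
  shows "u + w \<in> localization f"
proof -
  obtain M M' where "\<forall>N\<ge>M. \<exists>a. u = Fract a (f ^ N)" "\<forall>N\<ge>M'. \<exists>a. w = Fract a (f ^ N)"
    using localization_common_exponent assms by metis
  then obtain a b where "u = Fract a (f ^ (M + M'))" "w = Fract b (f ^ (M + M'))"
    by (meson le_add1 le_add2)
  hence "u + w = Fract (a + b) (f ^ (M + M'))"
    using assms(1) by (simp add: eq_fract algebra_simps)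
  thus ?thesis unfolding localization_def by blast
qed

context affine_forms
begin

lemma pd_L: "pd j (L s) = cst (slope s j)"
  by (subst L_eq) (simp add: pd_add pd_sum pd_cst_mult pd_var if_distrib[of "\<lambda>x. _ * x"] cong: if_cong)

lemma lie_const_L: "lie (\<lambda>i. cst (w i)) (L s) = cst (dir_deriv s w)"
proof -
  have "lie (\<lambda>i. cst (w i)) (L s) = (\<Sum>i\<in>UNIV. cst (slope s i * w i))"
    by (simp add: lie_def pd_L mult_single mult.commute)
  also have "\<dots> = cst (dir_deriv s w)"
    by (rule poly_mapping_eqI) (simp add: dir_deriv_def lookup_sum lookup_single when_def)
  finally show ?thesis .
qed

definition den :: "'i set \<Rightarrow> 'n cpoly" where
  "den A = (\<Prod>i\<in>A. L i)"

definition recip :: "'i set \<Rightarrow> 'n cpoly fract" where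
  "recip A = Fract 1 (den A)"

lemma den_nonzero [simp]: "den A \<noteq> 0"
  using L_nonzero by (cases "finite A") (auto simp: den_def)

lemma den_remove: "finite A \<Longrightarrow> s \<in> A \<Longrightarrow> den A = L s * den (A - {s})"
  by (simp add: den_def prod.remove)

lemma recip_nonzero [simp]: "recip A \<noteq> 0"
  by (simp add: recip_def Zero_fract_def eq_fract)

lemma recip_in_localization: "recip A \<in> localization (den A)"
  unfolding recip_def localization_def by (metis (mono_tags, lifting) mem_Collect_eq power_one_right)

lemma act_L_recip:
  assumes "finite A" "s \<in> A"
  shows "act (P * wpoly (L s)) (recip A) = act P (recip (A - {s}))"
proof -
  have "Fract (L s) 1 * recip A = recip (A - {s})"
    using L_nonzero by (simp add: recip_def den_remove[OF assms] eq_fract)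
  thus ?thesis by (simp add: act_mult act_wpoly)
qed

text \<open>
  The sums of functions each of which can be written with a denominator that omits one of the factors
  \<open>L\<^sub>k\<close>, \<open>k \<in> K\<close>. For \<open>K \<subseteq> A\<close>, these are the functions in \<open>R[1/f\<^sub>A]\<close> whose class in the top
  local cohomology of \<open>R[1/f\<^sub>A\<^sub>-\<^sub>K]\<close> along the zero set of \<open>K\<close>, computed by the Cech complex on the \<open>L\<^sub>k\<close>,
  is zero.
\<close>

definition less_polar :: "'i set \<Rightarrow> 'i set \<Rightarrow> 'n cpoly fract set" where
  "less_polar K A = {\<Sum>k\<in>K. u k | u. \<forall>k\<in>K. u k \<in> localization (den (A - {k}))}"

lemma less_polarI: "x = sum u K \<Longrightarrow> (\<And>k. k \<in> K \<Longrightarrow> u k \<in> localization (den (A - {k}))) \<Longrightarrow> x \<in> less_polar K A"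
  unfolding less_polar_def by blast

lemma less_polarE:
  assumes "x \<in> less_polar K A"
  obtains u where "x = sum u K" "\<And>k. k \<in> K \<Longrightarrow> u k \<in> localization (den (A - {k}))"
  using assms unfolding less_polar_def by blast

lemma less_polar_empty [simp]: "less_polar {} A = {0}"
  by (simp add: less_polar_def)

lemma less_polar_add: "x \<in> less_polar K A \<Longrightarrow> y \<in> less_polar K A \<Longrightarrow> x + y \<in> less_polar K A"
  by (elim less_polarE, rule less_polarI[where u = "\<lambda>k. _ k + _ k"])
     (auto simp: sum.distrib intro: localization_add)

lemma less_polar_act: "x \<in> less_polar K A \<Longrightarrow> act P x \<in> less_polar K A"
  by (elim less_polarE, rule less_polarI[where u = "\<lambda>k. act P (_ k)"])
     (auto simp: act_sum intro: act_localization)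

lemma less_polar_diff: "x \<in> less_polar K A \<Longrightarrow> y \<in> less_polar K A \<Longrightarrow> x - y \<in> less_polar K A"
  using less_polar_add[of x K A "- y"] less_polar_act[of y K A "- 1"]
  by (simp add: act_uminus_left act_one)

lemma less_polar_mono:
  assumes "x \<in> less_polar K A" "K \<subseteq> K'" "finite K'"
  shows "x \<in> less_polar K' A"
proof -
  from assms(1) obtain u where u: "x = sum u K" "\<And>k. k \<in> K \<Longrightarrow> u k \<in> localization (den (A - {k}))"
    by (rule less_polarE) blast
  show ?thesis
  proof (rule less_polarI[where u = "\<lambda>k. if k \<in> K then u k else 0"])
    show "x = (\<Sum>k\<in>K'. if k \<in> K then u k else 0)"
      using assms u(1) by (simp add: sum.If_cases Int_absorb1)
  qed (auto simp: u localization_zero)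
qed

lemma localization_less_polar:
  assumes "finite K" "k \<in> K" "x \<in> localization (den (A - {k}))"
  shows "x \<in> less_polar K A"
  using assms by (intro less_polar_mono[of x "{k}" A K] less_polarI[where u = "\<lambda>_. x"]) auto

text \<open>
  A denominator that omits \<open>L\<^sub>k\<close> becomes a factor \<open>L\<^sub>k\<^sup>N\<close> of the numerator over \<open>f\<^sub>A\<^sup>N\<close>. This turns
  statements about denominators into statements about ideals of polynomials.
\<close>

lemma less_polar_common_exponent:
  assumes "finite A" "K \<subseteq> A" "x \<in> less_polar K A"
  shows "\<exists>M. \<forall>N\<ge>M. \<exists>p\<in>pow_ideal K (\<lambda>_. N). x = Fract p (den A ^ N)"
proof -
  from assms(3) obtain u where u: "x = sum u K" "\<And>k. k \<in> K \<Longrightarrow> u k \<in> localization (den (A - {k}))"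
    by (rule less_polarE) blast
  have "\<forall>k\<in>K. \<exists>M. \<forall>N\<ge>M. \<exists>a. u k = Fract a (den (A - {k}) ^ N)"
    using u(2) localization_common_exponent[OF den_nonzero] by blast
  then obtain M where M: "\<And>k N. k \<in> K \<Longrightarrow> N \<ge> M k \<Longrightarrow> \<exists>a. u k = Fract a (den (A - {k}) ^ N)"
    by metis
  have K: "finite K" using assms finite_subset by blast
  show ?thesis
  proof (intro exI allI impI)
    fix N assume N: "N \<ge> (\<Sum>k\<in>K. M k)"
    have "\<forall>k\<in>K. \<exists>a. u k = Fract a (den (A - {k}) ^ N)"
      using M N member_le_sum[of _ K M] K by (meson order_trans zero_le)
    then obtain a where a: "\<And>k. k \<in> K \<Longrightarrow> u k = Fract (a k) (den (A - {k}) ^ N)"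
      by metis
    have "u k = Fract (a k * L k ^ N) (den A ^ N)" if "k \<in> K" for k
    proof -
      have "den A = L k * den (A - {k})" using den_remove assms that by blast
      thus ?thesis using L_nonzero by (simp add: a[OF that] eq_fract power_mult_distrib)
    qed
    hence "x = Fract (\<Sum>k\<in>K. a k * L k ^ N) (den A ^ N)"
      using K by (simp add: u(1) Fract_sum)
    thus "\<exists>p\<in>pow_ideal K (\<lambda>_. N). x = Fract p (den A ^ N)"
      by (intro bexI pow_idealI) auto
  qed
qed

text \<open>
  Localizing at \<open>L\<^sub>s\<close> is injective on the local cohomology along the zero set of \<open>K\<close>, as \<open>L\<^sub>s\<close> does not
  vanish identically on that zero set. On numerators this is the cancellation of \<open>L\<^sub>s\<^sup>N\<close> modulo the
  powers of the \<open>L\<^sub>k\<close>.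
\<close>

lemma less_polar_remove:
  assumes "finite A" "s \<in> A" "K \<subseteq> A - {s}" "dual K v" "residual K v s \<noteq> 0"
    and "x \<in> localization (den (A - {s}))" "x \<in> less_polar K A"
  shows "x \<in> less_polar K (A - {s})"
proof -
  let ?A = "A - {s}"
  have K: "finite K" using assms finite_subset by blast
  obtain M where M: "\<And>N. N \<ge> M \<Longrightarrow> \<exists>p\<in>pow_ideal K (\<lambda>_. N). x = Fract p (den A ^ N)"
    using less_polar_common_exponent[OF assms(1) _ assms(7)] assms(3) by blast
  obtain M' where M': "\<And>N. N \<ge> M' \<Longrightarrow> \<exists>a. x = Fract a (den ?A ^ N)"
    using localization_common_exponent[OF _ assms(6)] by auto
  define N where "N = M + M'"
  obtain p where p: "p \<in> pow_ideal K (\<lambda>_. N)" "x = Fract p (den A ^ N)"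
    using M[of N] by (auto simp: N_def)
  obtain a where a: "x = Fract a (den ?A ^ N)"
    using M'[of N] by (auto simp: N_def)
  have "a * L s ^ N = p"
    using p(2) a L_nonzero by (simp add: eq_fract den_remove[OF assms(1,2)] power_mult_distrib)
  hence "a * L s ^ N \<in> pow_ideal K (\<lambda>_. N)" using p(1) by simp
  hence "a \<in> pow_ideal K (\<lambda>_. N)"
    by (rule nonzerodivisor_power[rotated]) (rule nonzerodivisor_pow_ideal[OF K assms(4,5)])
  then obtain b where b: "a = (\<Sum>k\<in>K. b k * L k ^ N)" by (rule pow_idealE)
  show ?thesis
  proof (rule less_polarI[where u = "\<lambda>k. Fract (b k) (den (?A - {k}) ^ N)"])
    have "Fract (b k * L k ^ N) (den ?A ^ N) = Fract (b k) (den (?A - {k}) ^ N)" if "k \<in> K" for k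
    proof -
      have "den ?A = L k * den (?A - {k})" using den_remove assms that by blast
      thus ?thesis using L_nonzero by (simp add: eq_fract power_mult_distrib)
    qed
    thus "x = (\<Sum>k\<in>K. Fract (b k) (den (?A - {k}) ^ N))"
      using K by (simp add: a b Fract_sum)
  qed (auto simp: localization_def)
qed

text \<open>
  The left ideal generated by the obvious operators that map \<open>1/f\<^sub>A\<close> into \<open>less_polar K A\<close>: those of
  order one that kill it, and the \<open>L\<^sub>k\<close>, which cancel a factor of its denominator.
\<close>

definition rel_ideal :: "'i set \<Rightarrow> 'i set \<Rightarrow> 'n weyl set" where
  "rel_ideal K A = {Q + (\<Sum>k\<in>K. B k * wpoly (L k)) | Q B. Q \<in> order_one_ideal (recip A)}"

lemma rel_idealI: "x = Q + (\<Sum>k\<in>K. B k * wpoly (L k)) \<Longrightarrow> Q \<in> order_one_ideal (recip A) \<Longrightarrow> x \<in> rel_ideal K A"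
  unfolding rel_ideal_def by blast

lemma rel_idealE:
  assumes "x \<in> rel_ideal K A"
  obtains Q B where "x = Q + (\<Sum>k\<in>K. B k * wpoly (L k))" "Q \<in> order_one_ideal (recip A)"
  using assms unfolding rel_ideal_def by blast

lemma order_one_ideal_in_rel_ideal: "Q \<in> order_one_ideal (recip A) \<Longrightarrow> Q \<in> rel_ideal K A"
  by (rule rel_idealI[where B = "\<lambda>_. 0"]) auto

lemma left_ideal_rel_ideal: "left_ideal (rel_ideal K A)"
  unfolding left_ideal_def
proof (intro conjI ballI allI)
  note li = left_ideal_order_one_ideal[of "recip A"]
  show "0 \<in> rel_ideal K A" by (intro order_one_ideal_in_rel_ideal left_ideal_zero li)
  show "x + y \<in> rel_ideal K A" if xy: "x \<in> rel_ideal K A" "y \<in> rel_ideal K A" for x y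
  proof -
    obtain Q B where x: "x = Q + (\<Sum>k\<in>K. B k * wpoly (L k))" "Q \<in> order_one_ideal (recip A)"
      using xy(1) by (rule rel_idealE)
    obtain Q' B' where y: "y = Q' + (\<Sum>k\<in>K. B' k * wpoly (L k))" "Q' \<in> order_one_ideal (recip A)"
      using xy(2) by (rule rel_idealE)
    have "x + y = (Q + Q') + (\<Sum>k\<in>K. (B k + B' k) * wpoly (L k))"
      by (simp add: x y distrib_right sum.distrib)
    thus ?thesis by (rule rel_idealI) (intro left_ideal_add li x y)
  qed
  show "r * x \<in> rel_ideal K A" if "x \<in> rel_ideal K A" for x r
  proof -
    obtain Q B where x: "x = Q + (\<Sum>k\<in>K. B k * wpoly (L k))" "Q \<in> order_one_ideal (recip A)"
      using \<open>x \<in> rel_ideal K A\<close> by (rule rel_idealE)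
    have "r * x = r * Q + (\<Sum>k\<in>K. (r * B k) * wpoly (L k))"
      by (simp add: x distrib_left sum_distrib_left mult.assoc)
    thus ?thesis by (rule rel_idealI) (intro left_ideal_mult li x)
  qed
qed

lemma L_in_rel_ideal:
  assumes "finite K" "k \<in> K"
  shows "B * wpoly (L k) \<in> rel_ideal K A"
proof -
  have "B * wpoly (L k) = 0 + (\<Sum>j\<in>K. (if j = k then B else 0) * wpoly (L j))"
    using assms by (simp add: if_distrib[of "\<lambda>x. x * _"] cong: if_cong)
  thus ?thesis by (rule rel_idealI) (intro left_ideal_zero left_ideal_order_one_ideal)
qed

lemma rel_ideal_insert:
  assumes "P \<in> rel_ideal (insert s K) A" "finite K" "s \<notin> K"
  shows "\<exists>B. P - B * wpoly (L s) \<in> rel_ideal K A"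
proof -
  from assms(1) obtain Q B where P: "P = Q + (\<Sum>k\<in>insert s K. B k * wpoly (L k))" and Q: "Q \<in> order_one_ideal (recip A)"
    by (rule rel_idealE)
  have "P - B s * wpoly (L s) = Q + (\<Sum>k\<in>K. B k * wpoly (L k))"
    using assms by (simp add: P)
  thus ?thesis using rel_idealI Q by blast
qed

lemma act_rel_ideal:
  assumes "finite A" "K \<subseteq> A" "P \<in> rel_ideal K A"
  shows "act P (recip A) \<in> less_polar K A"
proof -
  from assms(3) obtain Q B where P: "P = Q + (\<Sum>k\<in>K. B k * wpoly (L k))" and Q: "Q \<in> order_one_ideal (recip A)"
    by (rule rel_idealE)
  have "act Q (recip A) = 0"
    using Q order_one_ideal_subset_ann by (auto simp: ann_def)
  hence "act P (recip A) = (\<Sum>k\<in>K. act (B k) (recip (A - {k})))"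
    using assms by (auto simp: P act_add_left act_sum_left act_L_recip intro!: sum.cong)
  thus ?thesis
    by (rule less_polarI) (intro act_localization recip_in_localization den_nonzero)
qed

lemma rel_ideal_mult_L:
  assumes "finite A" "s \<in> A" "P \<in> rel_ideal K (A - {s})"
  shows "P * wpoly (L s) \<in> rel_ideal K A"
proof -
  from assms(3) obtain Q B where P: "P = Q + (\<Sum>k\<in>K. B k * wpoly (L k))" and Q: "Q \<in> order_one_ideal (recip (A - {s}))"
    by (rule rel_idealE)
  have "P * wpoly (L s) = Q * wpoly (L s) + (\<Sum>k\<in>K. (B k * wpoly (L s)) * wpoly (L k))"
    by (simp add: P distrib_right sum_distrib_right mult.assoc wpoly_commute[of "L s"])
  moreover have "Q * wpoly (L s) \<in> order_one_ideal (recip A)"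
    using order_one_ideal_mult_linear[of "den (A - {s})" "L s" Q] Q L_nonzero assms
    by (simp add: recip_def den_remove)
  ultimately show ?thesis by (rule rel_idealI)
qed

subsection \<open>Operators that remove a factor of the denominator\<close>

lemma dir_deriv_diff: "dir_deriv s (\<lambda>j. a j - b j) = dir_deriv s a - dir_deriv s b"
  by (simp add: dir_deriv_def right_diff_distrib sum_subtractf)

lemma dir_deriv_scale: "dir_deriv s (\<lambda>j. c * a j) = c * dir_deriv s a"
  by (simp add: dir_deriv_def sum_distrib_left mult.left_commute)

lemma dir_deriv_sum: "dir_deriv s (\<lambda>j. \<Sum>k\<in>K. a k j) = (\<Sum>k\<in>K. dir_deriv s (a k))"
  unfolding dir_deriv_def sum_distrib_left by (rule sum.swap)

lemma dir_deriv_unit: "dir_deriv s (\<lambda>j. if j = i then 1 else 0) = slope s i"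
  by (simp add: dir_deriv_def if_distrib[of "\<lambda>x. _ * x"] cong: if_cong)

text \<open>
  The component of the \<open>i\<close>-th unit vector parallel to the common zero set of the forms in \<open>K\<close>.
\<close>

definition tangent :: "'i set \<Rightarrow> ('i \<Rightarrow> 'n \<Rightarrow> complex) \<Rightarrow> 'n \<Rightarrow> 'n \<Rightarrow> complex" where
  "tangent K v i j = (if j = i then 1 else 0) - (\<Sum>k\<in>K. slope k i * v k j)"

lemma dir_deriv_tangent: "dir_deriv s (tangent K v i) = slope s i - (\<Sum>k\<in>K. slope k i * dir_deriv s (v k))"
proof -
  have "dir_deriv s (tangent K v i) = dir_deriv s (\<lambda>j. if j = i then 1 else 0) - dir_deriv s (\<lambda>j. \<Sum>k\<in>K. slope k i * v k j)"
    unfolding tangent_def[abs_def] by (rule dir_deriv_diff)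
  thus ?thesis by (simp add: dir_deriv_unit dir_deriv_sum dir_deriv_scale)
qed

lemma dir_deriv_tangent_zero:
  assumes "finite K" "dual K v" "s \<in> K"
  shows "dir_deriv s (tangent K v i) = 0"
proof -
  have "(\<Sum>k\<in>K. slope k i * dir_deriv s (v k)) = (\<Sum>k\<in>K. if s = k then slope k i else 0)"
    using assms by (intro sum.cong) (auto simp: dual_def)
  thus ?thesis using assms by (simp add: dir_deriv_tangent)
qed

lemma wd_decomposition:
  "wd i = const_field (tangent K v i) + (\<Sum>k\<in>K. wpoly (cst (slope k i)) * const_field (v k))"
proof -
  have unit: "wd i = const_field (\<lambda>j. if j = i then 1 else 0)"
    by (simp add: const_field_def vfield_def if_distrib[of cst] if_distrib[of wpoly]
        if_distrib[of "\<lambda>x. x * _"] wpoly_one cong: if_cong)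
  have sum: "cst (\<Sum>k\<in>K. g k) = (\<Sum>k\<in>K. cst (g k))" for g :: "'i \<Rightarrow> complex"
    by (induction K rule: infinite_finite_induct) (simp_all add: cst_add)
  have "(\<Sum>k\<in>K. wpoly (cst (slope k i)) * const_field (v k))
      = const_field (\<lambda>j. \<Sum>k\<in>K. slope k i * v k j)"
    by (simp add: const_field_def wpoly_vfield vfield_sum sum cst_mult[symmetric])
  moreover have "const_field (\<lambda>j. a j + b j) = const_field a + const_field b" for a b :: "'n \<Rightarrow> complex"
    by (simp add: const_field_def vfield_def cst_add wpoly_add distrib_right sum.distrib)
  moreover have "(\<lambda>j. if j = i then 1 else 0) = (\<lambda>j. tangent K v i j + (\<Sum>k\<in>K. slope k i * v k j))"
    by (auto simp: tangent_def)
  ultimately show ?thesis unfolding unit by (simp only:)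
qed

lemma const_field_in_order_one_ideal:
  assumes "finite A" "\<And>s. s \<in> A \<Longrightarrow> dir_deriv s w = 0"
  shows "const_field w \<in> order_one_ideal (recip A)"
proof -
  have "lie (\<lambda>i. cst (w i)) (den A) = 0"
    unfolding den_def using assms lie_prod[of A "\<lambda>i. cst (w i)" L "\<lambda>_. 0"]
    by (simp add: lie_const_L)
  hence "act (const_field w + wpoly 0) (recip A) = 0"
    unfolding const_field_def recip_def
    by (subst act_first_order) (simp_all add: Zero_fract_def eq_fract)
  thus ?thesis
    unfolding const_field_def
    using first_order_in_order_one_ideal[of _ 0 "recip A"] by simp
qed

lemma commutator_L:
  "P * wpoly (L k) - wpoly (L k) * P
    = (\<Sum>i\<in>UNIV. (P * wpoly (var i) - wpoly (var i) * P) * wpoly (cst (slope k i)))"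
proof -
  have c: "wpoly (cst (slope k i)) * (wpoly (var i) * P) = wpoly (var i) * P * wpoly (cst (slope k i))"
    "P * (wpoly (cst (slope k i)) * wpoly (var i)) = P * wpoly (var i) * wpoly (cst (slope k i))" for i
    by (simp_all add: cst_central flip: mult.assoc)
  have "P * wpoly (L k) = wpoly (cst (const k)) * P
      + (\<Sum>i\<in>UNIV. P * wpoly (var i) * wpoly (cst (slope k i)))"
    by (simp only: L_eq[of k] wpoly_add wpoly_sum wpoly_mult distrib_left sum_distrib_left
        c(2) cst_central[of P "const k"])
  moreover have "wpoly (L k) * P = wpoly (cst (const k)) * P
      + (\<Sum>i\<in>UNIV. wpoly (var i) * P * wpoly (cst (slope k i)))"
    by (simp only: L_eq[of k] wpoly_add wpoly_sum wpoly_mult distrib_right sum_distrib_right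
        mult.assoc c(1)[unfolded mult.assoc])
  ultimately show ?thesis by (simp add: left_diff_distrib sum_subtractf)
qed

text \<open>
  The commutators \<open>[P, L\<^sub>k]\<close> have smaller order than \<open>P\<close>, and they satisfy the hypothesis as well: in
  \<open>P L\<^sub>k\<close> the factor \<open>L\<^sub>k\<close> cancels one of the denominator before \<open>P\<close> acts, and in \<open>L\<^sub>k P\<close> it multiplies a
  function that is in \<open>less_polar K K\<close> by assumption. By induction they belong to the ideal. In
  Euler's identity for the symbol of \<open>P\<close>, split each \<open>\<partial>\<^sub>i\<close> into a tangential part, which kills
  \<open>1/f\<^sub>K\<close> and so lies in the ideal, and a combination of the \<open>\<partial>\<^sub>v\<^sub>k\<close>: this expresses
  \<open>(m + 1) P\<close> by the \<open>[P, L\<^sub>k] \<partial>\<^sub>v\<^sub>k\<close> modulo the ideal and modulo lower order. Exchanging the two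
  factors again costs only lower order, and the induction hypothesis disposes of the remainder.

  For \<open>P = q\<close> of order zero the hypothesis puts \<open>q f\<^sub>K\<^sup>M\<close> into the ideal of the powers \<open>L\<^sub>k\<^sup>M\<^sup>+\<^sup>1\<close>, hence \<open>q\<close>
  into the ideal of the \<open>L\<^sub>k\<close>.
\<close>

lemma mem_rel_ideal_independent:
  assumes "finite K" "dual K v" "P \<in> fil m" "act P (recip K) \<in> less_polar K K"
  shows "P \<in> rel_ideal K K"
  using assms(3,4)
proof (induction m arbitrary: P)
  case (0 P)
  then obtain q where q: "P = wpoly q" by auto
  obtain M where M: "\<And>N. N \<ge> M \<Longrightarrow> \<exists>p\<in>pow_ideal K (\<lambda>_. N). act P (recip K) = Fract p (den K ^ N)"
    using less_polar_common_exponent[OF assms(1) order_refl 0(2)] by blast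
  obtain p where p: "p \<in> pow_ideal K (\<lambda>_. Suc M)" "act P (recip K) = Fract p (den K ^ Suc M)"
    using M[of "Suc M"] by auto
  have "act P (recip K) = Fract q (den K)"
    by (simp add: q act_wpoly recip_def)
  hence "q * (\<Prod>k\<in>K. L k ^ M) = p"
    using p(2) by (simp add: eq_fract prod_power_distrib[symmetric] flip: den_def)
  hence "q \<in> pow_ideal K (\<lambda>_. 1)"
    using colon_pow_ideal_prod[OF assms(1,2)] p(1) by metis
  then obtain b where "q = (\<Sum>k\<in>K. b k * L k ^ 1)" by (rule pow_idealE)
  hence "P = (\<Sum>k\<in>K. wpoly (b k) * wpoly (L k))"
    by (simp add: q wpoly_sum wpoly_mult)
  thus ?case
    by (simp only:) (intro left_ideal_sum left_ideal_rel_ideal L_in_rel_ideal assms(1))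
next
  case (Suc m P)
  note li = left_ideal_rel_ideal[of K K]
  let ?c = "\<lambda>i. P * wpoly (var i) - wpoly (var i) * P"
  define C where "C = (\<lambda>k. P * wpoly (L k) - wpoly (L k) * P)"
  have C: "C k \<in> fil m" for k
    unfolding C_def by (rule commutator_wpoly[OF Suc.prems(1)])
  have C_rel: "C k \<in> rel_ideal K K" if k: "k \<in> K" for k
  proof (rule Suc.IH[OF C])
    have "act (P * wpoly (L k)) (recip K) \<in> less_polar K K"
      unfolding act_L_recip[OF assms(1) k]
      by (intro localization_less_polar[OF assms(1) k] act_localization recip_in_localization den_nonzero)
    moreover have "act (wpoly (L k) * P) (recip K) \<in> less_polar K K"
      unfolding act_mult by (intro less_polar_act Suc.prems(2))
    ultimately show "act (C k) (recip K) \<in> less_polar K K"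
      unfolding C_def act_diff_left by (rule less_polar_diff)
  qed
  define E where "E = (\<Sum>i\<in>UNIV. ?c i * wd i)"
  define T where "T = (\<Sum>i\<in>UNIV. ?c i * const_field (tangent K v i))"
  have "E = T + (\<Sum>i\<in>UNIV. \<Sum>k\<in>K. ?c i * (wpoly (cst (slope k i)) * const_field (v k)))"
    unfolding E_def T_def
    by (subst wd_decomposition[of _ K v]) (simp only: distrib_left sum.distrib sum_distrib_left)
  also have "(\<Sum>i\<in>UNIV. \<Sum>k\<in>K. ?c i * (wpoly (cst (slope k i)) * const_field (v k)))
      = (\<Sum>k\<in>K. C k * const_field (v k))"
    by (subst sum.swap) (simp only: C_def commutator_L sum_distrib_right mult.assoc)
  finally have E: "E = T + (\<Sum>k\<in>K. C k * const_field (v k))" .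
  have T: "T \<in> rel_ideal K K"
    unfolding T_def using assms(1,2)
    by (intro left_ideal_sum[OF li] left_ideal_mult[OF li] order_one_ideal_in_rel_ideal
        const_field_in_order_one_ideal dir_deriv_tangent_zero)
  \<comment> \<open>\<open>X\<close> differs from \<open>E\<close> by commutators of constant vector fields with the \<open>C k\<close>, which have
    order at most \<open>m\<close>; so \<open>R\<close> has order at most \<open>m\<close> as well.\<close>
  define X where "X = T + (\<Sum>k\<in>K. const_field (v k) * C k)"
  define R where "R = (of_nat (Suc m) * P - E) - (\<Sum>k\<in>K. const_field (v k) * C k - C k * const_field (v k))"
  have PXR: "of_nat (Suc m) * P = X + R"
    by (simp add: X_def R_def E sum_subtractf)
  have X: "X \<in> rel_ideal K K"
    unfolding X_def
    by (intro left_ideal_add[OF li] left_ideal_sum[OF li] left_ideal_mult[OF li] T C_rel)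
  have "R \<in> rel_ideal K K"
  proof (rule Suc.IH)
    show "R \<in> fil m"
      unfolding R_def E_def
      by (intro fil_diff[OF symbol_euler[OF Suc.prems(1)]] fil_sum commutator_const_field C)
    have "R = of_nat (Suc m) * P - X" using PXR by simp
    hence "act R (recip K) = act (of_nat (Suc m)) (act P (recip K)) - act X (recip K)"
      by (simp only: act_diff_left act_mult)
    thus "act R (recip K) \<in> less_polar K K"
      using less_polar_diff[OF less_polar_act[OF Suc.prems(2)] act_rel_ideal[OF assms(1) order_refl X]] by metis
  qed
  hence "of_nat (Suc m) * P \<in> rel_ideal K K"
    unfolding PXR by (intro left_ideal_add[OF li] X)
  thus ?case by (rule left_ideal_of_nat_cancel[OF li]) simp
qed

text \<open>
  With \<open>E = \<Sum>\<^sub>k L\<^sub>k \<partial>\<^sub>v\<^sub>k\<close>, the operator \<open>E + |A|\<close> kills \<open>1/f\<^sub>A\<close> because \<open>E\<close> fixes every form in \<open>A\<close>, whereas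
  \<open>E + |K| = \<Sum>\<^sub>k \<partial>\<^sub>v\<^sub>k L\<^sub>k\<close>. The difference \<open>|A| - |K|\<close> is a nonzero constant in the ideal. This is
  where forms that depend on \<open>K\<close>, in particular repeated ones, are absorbed.
\<close>

lemma mem_rel_ideal_dependent:
  assumes "finite A" "K \<subset> A" "dual K v" "\<And>s. s \<in> A - K \<Longrightarrow> residual K v s = 0"
  shows "P \<in> rel_ideal K A"
proof -
  have K: "finite K" using assms finite_subset by blast
  note li = left_ideal_rel_ideal[of K A]
  define b where "b = (\<lambda>i. \<Sum>k\<in>K. L k * cst (v k i))"
  have "lie b (L s) = 1 * L s" if "s \<in> A" for s
  proof -
    have "lie b (L s) = (\<Sum>k\<in>K. L k * lie (\<lambda>i. cst (v k i)) (L s))"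
      unfolding lie_def b_def sum_distrib_left sum_distrib_right
      by (subst sum.swap) (simp only: mult.assoc)
    also have "\<dots> = L s - residual K v s"
      by (simp add: lie_const_L residual_def mult.commute)
    finally show ?thesis using assms(3,4) K that residual_member[of K v s] by (cases "s \<in> K") auto
  qed
  from lie_prod[OF assms(1) this] have "lie b (den A) = of_nat (card A) * den A"
    by (simp add: den_def)
  hence "act (vfield b + wpoly (of_nat (card A))) (recip A) = 0"
    unfolding recip_def by (subst act_first_order) (simp_all add: Zero_fract_def eq_fract)
  hence "vfield b + of_nat (card A) \<in> rel_ideal K A"
    using first_order_in_order_one_ideal[of b "of_nat (card A)" "recip A"]
    by (intro order_one_ideal_in_rel_ideal) (simp add: wpoly_of_nat)
  moreover have "vfield b = (\<Sum>k\<in>K. const_field (v k) * wpoly (L k)) - of_nat (card K)"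
  proof -
    have "const_field (v k) * wpoly (L k) = vfield (\<lambda>i. L k * cst (v k i)) + 1" if "k \<in> K" for k
      using assms(3) that
      by (simp add: const_field_def vfield_wpoly wpoly_vfield lie_const_L dual_def wpoly_one)
    thus ?thesis by (simp add: b_def vfield_sum sum.distrib)
  qed
  ultimately have "((\<Sum>k\<in>K. const_field (v k) * wpoly (L k)) - of_nat (card K)) + of_nat (card A) \<in> rel_ideal K A"
    by simp
  moreover have "(\<Sum>k\<in>K. const_field (v k) * wpoly (L k)) \<in> rel_ideal K A"
    by (intro left_ideal_sum[OF li] L_in_rel_ideal K)
  ultimately have "((\<Sum>k\<in>K. const_field (v k) * wpoly (L k)) - of_nat (card K)) + of_nat (card A)
      - (\<Sum>k\<in>K. const_field (v k) * wpoly (L k)) \<in> rel_ideal K A"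
    by (rule left_ideal_diff[OF li])
  moreover have "of_nat (card A) - of_nat (card K) = (of_nat (card A - card K) :: 'n weyl)"
    using psubset_card_mono[OF assms(1,2)] by (simp add: of_nat_diff)
  ultimately have "of_nat (card A - card K) * (1 :: 'n weyl) \<in> rel_ideal K A"
    by (simp add: algebra_simps)
  hence "1 \<in> rel_ideal K A"
    by (rule left_ideal_of_nat_cancel[OF li]) (use psubset_card_mono[OF assms(1,2)] in simp)
  thus ?thesis using left_ideal_mult[OF li, of 1 P] by simp
qed

lemma residual_eq:
  "residual K v s = cst (const s - (\<Sum>k\<in>K. dir_deriv s (v k) * const k)) + (\<Sum>i\<in>UNIV. cst (dir_deriv s (tangent K v i)) * var i)"
proof -
  have diff: "cst (a - b) = cst a - cst b" for a b :: complex
    by (rule single_diff)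
  have sum: "cst (\<Sum>k\<in>K. g k) = (\<Sum>k\<in>K. cst (g k))" for g :: "'i \<Rightarrow> complex"
    by (induction K rule: infinite_finite_induct) (simp_all add: cst_add)
  have "(\<Sum>k\<in>K. cst (dir_deriv s (v k)) * L k)
     = (\<Sum>k\<in>K. cst (dir_deriv s (v k) * const k)) + (\<Sum>k\<in>K. \<Sum>i\<in>UNIV. cst (slope k i * dir_deriv s (v k)) * var i)"
    by (subst L_eq) (simp only: distrib_left sum.distrib sum_distrib_left cst_mult mult.assoc mult.left_commute)
  also have "(\<Sum>k\<in>K. \<Sum>i\<in>UNIV. cst (slope k i * dir_deriv s (v k)) * var i)
      = (\<Sum>i\<in>UNIV. cst (\<Sum>k\<in>K. slope k i * dir_deriv s (v k)) * var i)"
    unfolding sum sum_distrib_right by (rule sum.swap)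
  finally show ?thesis
    unfolding residual_def dir_deriv_tangent diff left_diff_distrib sum_subtractf sum[of "\<lambda>k. dir_deriv s (v k) * const k"]
    by (subst L_eq) simp
qed

text \<open>
  The component of some unit vector parallel to the zero set of \<open>K\<close>, rescaled, serves as the direction
  dual to \<open>L\<^sub>s\<close>; the old directions are corrected by multiples of it.
\<close>

lemma dual_extend:
  assumes "finite K" "dual K v" "s \<notin> K" "dir_deriv s (tangent K v i) \<noteq> 0"
  obtains v' where "dual (insert s K) v'"
proof
  define w where "w = (\<lambda>j. inverse (dir_deriv s (tangent K v i)) * tangent K v i j)"
  define v' where "v' = (\<lambda>k. if k = s then w else (\<lambda>j. v k j - dir_deriv s (v k) * w j))"
  have w: "dir_deriv k w = (if k = s then 1 else 0)" if "k \<in> insert s K" for k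
    using that assms dir_deriv_tangent_zero[OF assms(1,2)] by (auto simp: w_def dir_deriv_scale)
  show "dual (insert s K) v'"
    unfolding dual_def
  proof (intro ballI)
    fix j k assume jk: "j \<in> insert s K" "k \<in> insert s K"
    show "dir_deriv j (v' k) = (if j = k then 1 else 0)"
    proof (cases "k = s")
      case True
      thus ?thesis using w[OF jk(1)] by (simp add: v'_def)
    next
      case False
      hence "dir_deriv j (v' k) = dir_deriv j (v k) - dir_deriv s (v k) * dir_deriv j w"
        by (simp add: v'_def dir_deriv_diff dir_deriv_scale)
      thus ?thesis using w[OF jk(1)] False jk assms(2,3) by (auto simp: dual_def)
    qed
  qed
qed

text \<open>
  The strengthened claim, with \<open>A = K \<union> S\<close>. Keeping \<open>K\<close> arbitrary in the induction is what makes
  it possible to move a form from \<open>S\<close> to \<open>K\<close> instead of restricting the arrangement to a hyperplane.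
\<close>

lemma mem_rel_ideal_if_act_less_polar:
  assumes "finite S" "finite K" "K \<inter> S = {}" "dual K v"
    and "act P (recip (K \<union> S)) \<in> less_polar K (K \<union> S)"
  shows "P \<in> rel_ideal K (K \<union> S)"
  using assms
proof (induction "card S" arbitrary: S K v P rule: less_induct)
  case less
  note prems = less.prems
  consider "S = {}" | s where "s \<in> S" "residual K v s \<noteq> 0" | "S \<noteq> {}" "\<forall>s\<in>S. residual K v s = 0"
    by blast
  thus ?case
  proof cases
    case 1
    thus ?thesis using prems mem_rel_ideal_independent fil_exhaustive by (metis Un_empty_right)
  next
    case 3
    thus ?thesis using prems by (intro mem_rel_ideal_dependent[where v = v]) auto
  next
    case (2 s)
    define S' where "S' = S - {s}"
    define A where "A = K \<union> S"
    have S': "card S' < card S" "finite S'"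
      unfolding S'_def using card_Diff1_less[OF prems(1) 2(1)] prems(1) by (simp_all only: finite_Diff)
    have s: "s \<in> A" "s \<notin> K" and A: "finite A" "A - {s} = K \<union> S'" "A = insert s K \<union> S'" "K \<subseteq> A" "K \<subseteq> A - {s}"
      using 2 prems by (auto simp: A_def S'_def)
    note li = left_ideal_rel_ideal[of K A]
    \<comment> \<open>If \<open>L\<^sub>s\<close> is not constant on the zero set of \<open>K\<close>, then \<open>s\<close> can be moved to \<open>K\<close>; otherwise it is a
      nonzero constant there, hence a unit modulo the \<open>L\<^sub>k\<close>.\<close>
    have "\<exists>B. P - B * wpoly (L s) \<in> rel_ideal K A"
    proof (cases "\<exists>i. dir_deriv s (tangent K v i) \<noteq> 0")
      case True
      then obtain v' where v': "dual (insert s K) v'"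
        using dual_extend[OF prems(2,4) s(2)] by blast
      have "act P (recip A) \<in> less_polar (insert s K) A"
        using prems(2,5) unfolding A_def by (auto intro: less_polar_mono[of _ K])
      moreover have "finite (insert s K)" "insert s K \<inter> S' = {}"
        using prems(2,3) by (auto simp: S'_def)
      ultimately have "P \<in> rel_ideal (insert s K) A"
        using less.hyps[OF S' _ _ v', of P] by (simp only: A(3)[symmetric])
      thus ?thesis using rel_ideal_insert prems(2) s(2) by blast
    next
      case False
      define c where "c = const s - (\<Sum>k\<in>K. dir_deriv s (v k) * const k)"
      have residual: "residual K v s = cst c" using False by (simp add: residual_eq c_def)
      hence c: "c \<noteq> 0" using 2(2) by auto
      have "L s = cst c + (\<Sum>k\<in>K. cst (dir_deriv s (v k)) * L k)"
        using residual by (simp add: residual_def algebra_simps)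
      hence "wpoly (L s) = wpoly (cst c) + (\<Sum>k\<in>K. wpoly (cst (dir_deriv s (v k))) * wpoly (L k))"
        by (simp add: wpoly_add wpoly_sum wpoly_mult)
      moreover have "wpoly (cst (1 / c)) * wpoly (cst c) = (1 :: 'n weyl)"
        using c by (simp add: mult_single wpoly_one flip: wpoly_mult)
      ultimately have "P - P * wpoly (cst (1 / c)) * wpoly (L s)
        = - (\<Sum>k\<in>K. P * wpoly (cst (1 / c)) * wpoly (cst (dir_deriv s (v k))) * wpoly (L k))"
        by (simp add: distrib_left sum_distrib_left mult.assoc)
      also have "\<dots> \<in> rel_ideal K A"
        by (intro left_ideal_uminus[OF li] left_ideal_sum[OF li] L_in_rel_ideal prems)
      finally show ?thesis by blast
    qed
    then obtain B where B: "P - B * wpoly (L s) \<in> rel_ideal K A" by blast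
    \<comment> \<open>\<open>B\<close> satisfies the hypothesis for the arrangement without \<open>L\<^sub>s\<close>.\<close>
    have "act B (recip (A - {s})) = act P (recip A) - act (P - B * wpoly (L s)) (recip A)"
      by (simp add: act_diff_left act_L_recip[OF A(1) s(1)])
    moreover have "\<dots> \<in> less_polar K A"
      using prems(5) unfolding A_def[symmetric] by (rule less_polar_diff[OF _ act_rel_ideal[OF A(1,4) B]])
    moreover have "act B (recip (A - {s})) \<in> localization (den (A - {s}))"
      by (intro act_localization recip_in_localization den_nonzero)
    ultimately have "act B (recip (A - {s})) \<in> less_polar K (A - {s})"
      using less_polar_remove[OF A(1) s(1) A(5) prems(4) 2(2)] by metis
    moreover have "K \<inter> S' = {}" using prems(3) by (auto simp: S'_def)
    ultimately have "B \<in> rel_ideal K (A - {s})"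
      using less.hyps[OF S' prems(2) _ prems(4), of B] by (simp only: A(2)[symmetric])
    hence "B * wpoly (L s) \<in> rel_ideal K A" by (rule rel_ideal_mult_L[OF A(1) s(1)])
    from left_ideal_add[OF li B this] show ?thesis by (simp add: A_def)
  qed
qed

corollary ann_recip_eq_order_one_ideal:
  assumes "finite A"
  shows "ann (recip A) = order_one_ideal (recip A)"
proof
  show "ann (recip A) \<subseteq> order_one_ideal (recip A)"
  proof
    fix P assume "P \<in> ann (recip A)"
    hence "P \<in> rel_ideal {} ({} \<union> A)"
      using assms by (intro mem_rel_ideal_if_act_less_polar) (auto simp: dual_def ann_def)
    thus "P \<in> order_one_ideal (recip A)" by (auto elim: rel_idealE)
  qed
qed (rule order_one_ideal_subset_ann)

end

section \<open>The annihilator of the inverse of an arrangement\<close>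

theorem theorem5p3:
  fixes d :: nat and L :: "nat \<Rightarrow> 'n::{finite,linorder} cpoly" and f :: "'n cpoly"
  assumes "\<And>i. i \<in> {1..d} \<Longrightarrow> total_degree (L i) = 1"
    and "f = (\<Prod>i=1..d. L i)"
  shows "\<exists>S. (\<forall>P\<in>S. weyl_order P = 1) \<and> ann (Fraction_Field.Fract 1 f) = left_ideal hull S"
proof -
  \<comment> \<open>Extended to a total family by \<open>1\<close>, which is affine and nonzero.\<close>
  define L' where "L' = (\<lambda>i. if i \<in> {1..d} then L i else 1)"
  have deg: "supp_deg (0 :: 'n cpoly) = 0" "supp_deg (1 :: 'n cpoly) = 0"
    by (simp_all add: supp_deg_def mdeg_unit)
  have "supp_deg (L' i) \<le> 1" for i
    using assms(1)[of i] deg by (auto simp: L'_def)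
  note L'_eq = affine_if_total_degree_le_1[OF this]
  have nonzero: "L' i \<noteq> 0" for i
    using assms(1)[of i] deg by (auto simp: L'_def)
  interpret affine_forms L' "\<lambda>i. Poly_Mapping.lookup (L' i) 0"
      "\<lambda>i j. Poly_Mapping.lookup (L' i) (Poly_Mapping.single j 1)"
    by unfold_locales (rule L'_eq nonzero)+
  have "den {1..d} = f"
    unfolding den_def assms(2) by (rule prod.cong) (auto simp: L'_def)
  hence "ann (Fract 1 f) = left_ideal hull {P. weyl_order P = 1 \<and> act P (Fract 1 f) = 0}"
    using ann_recip_eq_order_one_ideal[of "{1..d}"] by (simp add: recip_def order_one_ideal_def)
  thus ?thesis by (intro exI[of _ "{P. weyl_order P = 1 \<and> act P (Fract 1 f) = 0}"]) simp
qed

end
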